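(* Let $[a,b]\subset\mathbb{R}$ be a compact interval, let $n$ be a positive integer, and let $f:[a,b]\to\mathbb{R}$ be such that $f^{(n-1)}$ exists on $[a,b]$ and $f^{(n-1)}\in ACG_*$ on $[a,b]$ (so that $f^{(n)}$ exists almost everywhere and is Henstock--Kurzweil integrable on $[a,b]$). Let $x_0\in[a,b]$ be a point at which $f^{(n)}$ exists. Define, for $x\in[a,b]$, $$P_{n,x_0}(x)=\sum_{k=0}^{n-1}\frac{f^{(k)}(a)(x-a)^k}{k!}+\frac{f^{(n)}(x_0)(x-a)^n}{n!},\qquad R_{n,x_0}(x)=f(x)-P_{n,x_0}(x).$$ Then $$\|R_{n,x_0}\|\leq \frac{(b-a)^n}{n!}\,\|f^{(n)}(\cdot)-f^{(n)}(x_0)\|.$$ For all $x\in[a,b]$, $$|R_{n,x_0}(x)|\leq \frac{(x-a)^{n-1}}{(n-1)!}\,\|f^{(n)}(\cdot)-f^{(n)}(x_0)\|_{[a,x]}.$$ And $$\|R_{n,x_0}\|_p\leq \frac{(b-a)^{n-1+1/p}}{(n-1)!\,[(n-1)p+1]^{1/p}}\,\|f^{(n)}(\cdot)-f^{(n)}(x_0)\|\quad\text{for } 1\leq p<\infty,$$ $$\|R_{n,x_0}\|_\infty\leq \frac{(b-a)^{n-1}}{(n-1)!}\,\|f^{(n)}(\cdot)-f^{(n)}(x_0)\|.$$ Here $\|\cdot\|$ (no subscript) is the Alexiewicz norm on $[a,b]$, $\|\cdot\|_{[a,x]}$ is the Alexiewicz norm on $[a,x]$, and $\|\cdot\|_p$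 is the Lebesgue $p$-norm on $[a,b]$.
   Context: Derivatives: $f^{(0)}=f$, and derivatives at the endpoints $a,b$ are one-sided. The convention $0^0=1$ is used. Henstock--Kurzweil integral: $g:[a,b]\to\mathbb{R}$ is Henstock--Kurzweil integrable with integral $A$ if for every $\varepsilon>0$ there is a function $\delta:[a,b]\to(0,\infty)$ such that $|\sum_i g(z_i)(x_i-x_{i-1})-A|<\varepsilon$ for every tagged partition $a=x_0<\dots<x_N=b$ with tags $z_i\in[x_{i-1},x_i]\subset(z_i-\delta(z_i),z_i+\delta(z_i))$. The integral is unaffected by changing $g$ on a Lebesgue null set, so functions defined only almost everywhere can be integrated (assign arbitrary values elsewhere). All integrals of $f^{(n)}$ are in this sense. The class $ACG_*$: a function $F:[a,b]\to\mathbb{R}$ is $AC_*$ on a set $E\subset[a,b]$ if for every $\varepsilon>0$ there is $\eta>0$ such that $\sum_i \sup_{s,t\in[c_i,d_i]}|F(s)-F(t)|<\varepsilon$ for every finite collection of non-overlapping intervals $[c_i,d_i]$ with endpoints in $E$ and $\sum_i(d_i-c_i)<\eta$. $F\in ACG_*$ on $[a,b]$ means that $F$ is continuous on $[a,b]$ and $[a,b]$ is a countable union of sets on each of which $F$ is $AC_*$. (Fundamental theorem: if $F\in ACG_*$ then $F'$ exists almost everywhere, $F'$ is Henstock--Kurzweil integrable, and $\int_a^xF'=F(x)-F(a)$ for all $x\in[a,b]$.) Alexiewicz norm: for $g$ Henstock--Kurzweil integrable on $I=[a,c]$, $\|g\|_{I}=\sup_{a\le x\le c}\left|\int_a^x g\right|$;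 the notation $\|g\|$ means $\|g\|_{[a,b]}$. *)

theory Defs
  imports "HOL-Analysis.Analysis" "HOL-Probability.Essential_Supremum"
begin

(* Taking derivatives within S = {a..b} makes them one-sided at a and b and independent of
   the values of f outside S.  Where no derivative exists the value is arbitrary. *)
definition nth_deriv_within :: "real set \<Rightarrow> nat \<Rightarrow> (real \<Rightarrow> real) \<Rightarrow> real \<Rightarrow> real" where
  "nth_deriv_within S k f = ((\<lambda>g x. vector_derivative g (at x within S)) ^^ k) f"

(* The next derivative of f, of order k + 1, exists at x. *)
definition has_next_deriv_at :: "real set \<Rightarrow> nat \<Rightarrow> (real \<Rightarrow> real) \<Rightarrow> real \<Rightarrow> bool" where
  "has_next_deriv_at S k f x \<longleftrightarrow> nth_deriv_within S k f differentiable (at x within S)"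

(* The oscillations are taken in ennreal, so that they are infinite, rather than unspecified,
   on intervals where F is unbounded. *)
definition AC_star_on :: "real set \<Rightarrow> (real \<Rightarrow> real) \<Rightarrow> bool" where
  "AC_star_on E F \<longleftrightarrow>
    (\<forall>\<epsilon>>0. \<exists>\<eta>>0. \<forall>(N::nat) c d.
      (\<forall>i<N. c i \<in> E \<and> d i \<in> E \<and> c i \<le> d i) \<and>
      disjoint_family_on (\<lambda>i. {c i<..<d i}) {..<N} \<and>
      (\<Sum>i<N. d i - c i) < \<eta> \<longrightarrow>
      (\<Sum>i<N. SUP s\<in>{c i..d i}. SUP t\<in>{c i..d i}. ennreal \<bar>F s - F t\<bar>) < ennreal \<epsilon>)"

definition ACG_star :: "real \<Rightarrow> real \<Rightarrow> (real \<Rightarrow> real) \<Rightarrow> bool" where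
  "ACG_star a b F \<longleftrightarrow>
    continuous_on {a..b} F \<and>
    (\<exists>E :: nat \<Rightarrow> real set. (\<Union>i. E i) = {a..b} \<and> (\<forall>i. AC_star_on (E i) F))"

(* Meaningful for g integrable on {a..c}; the integral is the Henstock-Kurzweil integral. *)
definition alexiewicz_norm :: "real \<Rightarrow> real \<Rightarrow> (real \<Rightarrow> real) \<Rightarrow> real" where
  "alexiewicz_norm a c g = (SUP x\<in>{a..c}. \<bar>integral {a..x} g\<bar>)"

(* For 1 \<le> p < \<infinity>; meaningful if the p-th power of \<bar>g\<bar> is Lebesgue integrable on {a..b}. *)
definition Lp_norm :: "real \<Rightarrow> real \<Rightarrow> real \<Rightarrow> (real \<Rightarrow> real) \<Rightarrow> real" where
  "Lp_norm p a b g = (LINT x|lebesgue_on {a..b}. \<bar>g x\<bar> powr p) powr (1 / p)"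

definition Linf_norm :: "real \<Rightarrow> real \<Rightarrow> (real \<Rightarrow> real) \<Rightarrow> ereal" where
  "Linf_norm a b g = esssup (lebesgue_on {a..b}) (\<lambda>x. ereal \<bar>g x\<bar>)"

definition taylor_P :: "real \<Rightarrow> real \<Rightarrow> nat \<Rightarrow> real \<Rightarrow> (real \<Rightarrow> real) \<Rightarrow> real \<Rightarrow> real" where
  "taylor_P a b n x0 f x =
    (\<Sum>k<n. nth_deriv_within {a..b} k f a * (x - a) ^ k / fact k)
      + nth_deriv_within {a..b} n f x0 * (x - a) ^ n / fact n"

definition taylor_R :: "real \<Rightarrow> real \<Rightarrow> nat \<Rightarrow> real \<Rightarrow> (real \<Rightarrow> real) \<Rightarrow> real \<Rightarrow> real" where
  "taylor_R a b n x0 f x = f x - taylor_P a b n x0 f x"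

end

(* The heart of the matter is the fundamental theorem of calculus for ACG_*-functions F.

   Such a function is differentiable almost everywhere because, on a set E on which F is AC_*,
   the oscillation of F over an interval with endpoints in E is dominated by the increment of an
   increasing function V.  Adding a suitable extension of 2V to F gives a function that is squeezed
   between two increasing functions agreeing with it on E, and increasing functions are
   differentiable almost everywhere by Vitali's covering theorem.

   Its derivative integrates to F because the increments of F over tagged intervals with tags in a
   null set are negligible: up to countably many tags, handled by continuity, each tag is followed
   by nearby points of E, so that the increments are controlled by intervals with endpoints in E
   and small total length.

   Finally, the (n-1)-st derivative of the remainder is the indefinite integral of
   f^(n) - f^(n)(x0), hence bounded by the Alexiewicz norm, and the remainder vanishes at a together
   with its derivatives of order less than n, so that integrating n - 1 times gives the pointwise
   estimate, from which the others follow. *)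
theory Submission imports Defs begin

section \<open>Monotone functions are differentiable almost everywhere\<close>

text \<open>AC_* controls only intervals with both endpoints in E, and E is an arbitrary set. This
  shapes both halves of the argument. For differentiability, oscillation sums are controlled only
  below a threshold of total length, so V exists only between two points of E closer than the
  threshold; it is the supremum of the sums over families of disjoint intervals up to the given
  point. Points of E that lie between no two such points are isolated in E from one side, hence
  countable. Since the sets in question need not be measurable, the monotone case works with open
  sets that cover them up to null sets. For integration, differentiability almost everywhere is not
  enough, as the Cantor function shows, so AC_* is used a second time, with an open set of small
  measure around the null set to bound total lengths. As tags lie anywhere in their intervals, each
  interval is cut at its tag and the two halves are estimated separately. In the Taylor part, f^(n)
  need not be absolutely integrable; the first integration is therefore absorbed into the Alexiewicz
  norm, and absolute values enter the integrals only afterwards.\<close>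

text \<open>A compact interval is a closed ball about its midpoint, so Vitali's theorem for balls
  applies. The chosen intervals are countably many, hence their endpoints form a null set and the
  open intervals cover as well as the closed ones.\<close>

lemma Vitali_covering_intervals:
  fixes A :: "real set"
  assumes cov: "\<And>x d. x \<in> A \<Longrightarrow> 0 < d \<Longrightarrow> \<exists>u v. u \<le> x \<and> x \<le> v \<and> u < v \<and> v - u < d \<and> P u v"
  obtains C where "countable C" "\<forall>p\<in>C. fst p < snd p \<and> P (fst p) (snd p)"
    "pairwise (\<lambda>p q. disjnt {fst p..snd p} {fst q..snd q}) C"
    "negligible (A - (\<Union>p\<in>C. {fst p<..<snd p}))"
proof -
  define K where "K = {p::real\<times>real. fst p < snd p \<and> P (fst p) (snd p)}"
  define m where "m = (\<lambda>p::real\<times>real. (fst p + snd p) / 2)"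
  define r where "r = (\<lambda>p::real\<times>real. (snd p - fst p) / 2)"
  have cb: "cball (m p) (r p) = {fst p..snd p}" for p
    by (simp add: m_def r_def cball_eq_atLeastAtMost field_simps)
  have cov': "\<exists>p. p \<in> K \<and> x \<in> cball (m p) (r p) \<and> r p < d" if "x \<in> A" "0 < d" for x d
  proof -
    from cov[OF that(1), of d] that obtain u v where "u \<le> x" "x \<le> v" "u < v" "v - u < d" "P u v" by blast
    then show ?thesis unfolding cb by (intro exI[of _ "(u,v)"]) (auto simp: K_def r_def)
  qed
  have r: "0 < r p" if "p \<in> K" for p using that by (auto simp: K_def r_def)
  obtain C where C: "countable C" "C \<subseteq> K"
     "pairwise (\<lambda>i j. disjnt (cball (m i) (r i)) (cball (m j) (r j))) C"
     "negligible (A - (\<Union>i \<in> C. cball (m i) (r i)))"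
    by (rule Vitali_covering_theorem_cballs[of K r A m, OF r cov'])
  have "negligible (fst ` C \<union> snd ` C)"
    unfolding negligible_iff_null_sets using C(1)
    by (intro null_sets_completionI countable_imp_null_set_lborel) auto
  then have "negligible (A - (\<Union>p\<in>C. {fst p<..<snd p}))"
  proof (rule negligible_subset[OF negligible_Un[OF C(4)]], intro subsetI)
    fix x assume x: "x \<in> A - (\<Union>p\<in>C. {fst p<..<snd p})"
    show "x \<in> A - (\<Union>i\<in>C. cball (m i) (r i)) \<union> (fst ` C \<union> snd ` C)"
    proof (cases "\<exists>p\<in>C. x \<in> {fst p..snd p}")
      case True
      then obtain p where "p \<in> C" "x \<in> {fst p..snd p}" by blast
      moreover from this x have "x \<notin> {fst p<..<snd p}" by blast
      ultimately have "x = fst p \<or> x = snd p" by auto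
      then show ?thesis using \<open>p \<in> C\<close> by blast
    qed (use x cb in auto)
  qed
  then show ?thesis using C that[of C] unfolding cb by (auto simp: K_def)
qed

text \<open>Monotonicity carries disjoint closed intervals to non-overlapping intervals of values.
  These replace the images under \<open>f\<close>: they are open whatever \<open>f\<close> is, and
  their lengths are the increments, jumps included. The integral over \<open>count_space C\<close>
  is a countable sum that needs no enumeration.\<close>

lemma emeasure_mono_image_intervals:
  fixes f :: "real \<Rightarrow> real"
  assumes "mono f" "countable C" and lt: "\<And>p. p \<in> C \<Longrightarrow> fst p < snd p"
    and dis: "pairwise (\<lambda>p q. disjnt {fst p..snd p} {fst q..snd q}) C"
  shows "emeasure lborel (\<Union>p\<in>C. {f (fst p)<..<f (snd p)})
     = (\<integral>\<^sup>+p. ennreal (f (snd p) - f (fst p)) \<partial>count_space C)"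
proof -
  have "disjoint_family_on (\<lambda>p. {f (fst p)<..<f (snd p)}) C"
    unfolding disjoint_family_on_def
  proof (intro ballI impI)
    fix p q assume pq: "p \<in> C" "q \<in> C" "p \<noteq> q"
    then have "disjnt {fst p..snd p} {fst q..snd q}" using dis by (auto simp: pairwise_def)
    then have "snd p < fst q \<or> snd q < fst p"
      using lt[OF pq(1)] lt[OF pq(2)] unfolding disjnt_iff
      by (metis atLeastAtMost_iff less_eq_real_def linorder_not_le order_refl)
    then have "f (snd p) \<le> f (fst q) \<or> f (snd q) \<le> f (fst p)"
      using \<open>mono f\<close> by (auto simp: mono_def)
    then show "{f (fst p)<..<f (snd p)} \<inter> {f (fst q)<..<f (snd q)} = {}" by auto
  qed
  then have "emeasure lborel (\<Union>p\<in>C. {f (fst p)<..<f (snd p)})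
     = (\<integral>\<^sup>+p. emeasure lborel {f (fst p)<..<f (snd p)} \<partial>count_space C)"
    using \<open>countable C\<close> by (intro emeasure_UN_countable) auto
  also have "\<dots> = (\<integral>\<^sup>+p. ennreal (f (snd p) - f (fst p)) \<partial>count_space C)"
    using lt \<open>mono f\<close> by (intro nn_integral_cong) (auto simp: mono_def less_imp_le)
  finally show ?thesis .
qed

lemma emeasure_intervals:
  assumes "countable C" and lt: "\<And>p. p \<in> C \<Longrightarrow> fst p < (snd p :: real)"
    and dis: "pairwise (\<lambda>p q. disjnt {fst p..snd p} {fst q..snd q}) C"
  shows "emeasure lborel (\<Union>p\<in>C. {fst p<..<snd p}) = (\<integral>\<^sup>+p. ennreal (snd p - fst p) \<partial>count_space C)"
  using emeasure_mono_image_intervals[of "\<lambda>x. x", OF _ assms] by (simp add: mono_def)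

section \<open>Slopes over arbitrarily short intervals\<close>

text \<open>The intervals contain \<open>x\<close> but need not be anchored there, so a single
  notion of slope serves in place of the four Dini derivatives.\<close>

definition small_intervals :: "(real \<Rightarrow> real \<Rightarrow> bool) \<Rightarrow> real \<Rightarrow> bool" where
  "small_intervals P x \<longleftrightarrow> (\<forall>d>0. \<exists>u v. u \<le> x \<and> x \<le> v \<and> u < v \<and> v - u < d \<and> P u v)"

lemma small_intervals_open:
  assumes "small_intervals P x" "open U" "x \<in> U"
  shows "small_intervals (\<lambda>u v. {u..v} \<subseteq> U \<and> P u v) x"
  unfolding small_intervals_def
proof (intro allI impI)
  fix d :: real assume "0 < d"
  obtain e where e: "e > 0" "ball x e \<subseteq> U" using assms open_contains_ball by blast
  obtain u v where uv: "u \<le> x" "x \<le> v" "u < v" "v - u < min d e" "P u v"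
    using assms(1) \<open>0 < d\<close> e(1) unfolding small_intervals_def by (metis min_less_iff_conj)
  have "{u..v} \<subseteq> ball x e" using uv by (auto simp: dist_real_def)
  then show "\<exists>u v. u \<le> x \<and> x \<le> v \<and> u < v \<and> v - u < d \<and> {u..v} \<subseteq> U \<and> P u v"
    using uv e by (intro exI[of _ u] exI[of _ v]) auto
qed

lemma small_intervals_mono:
  assumes "small_intervals P x" "\<And>u v. P u v \<Longrightarrow> Q u v"
  shows "small_intervals Q x"
  using assms unfolding small_intervals_def by metis

lemma not_small_intervalsE:
  assumes "\<not> small_intervals P x"
  obtains d where "d > 0" "\<And>u v. u \<le> x \<Longrightarrow> x \<le> v \<Longrightarrow> u < v \<Longrightarrow> v - u < d \<Longrightarrow> \<not> P u v"
  using assms unfolding small_intervals_def by blast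

text \<open>\<open>U\<close> is the union of a Vitali family of steep intervals inside those of
  \<open>C\<close>. Each has length at most its increment divided by \<open>q\<close>, and the
  increments are lengths of disjoint intervals of values lying in those of \<open>C\<close>.\<close>

lemma steep_cover:
  fixes f :: "real \<Rightarrow> real"
  assumes "mono f" "0 < q" 
    and steep: "\<And>x. x \<in> A \<Longrightarrow> small_intervals (\<lambda>u v. q * (v - u) \<le> f v - f u) x"
    and AC: "A \<subseteq> (\<Union>p\<in>C. {fst p<..<snd p})"
  obtains U where "open U" "negligible (A - U)"
    "emeasure lborel U \<le> ennreal (1/q) * emeasure lborel (\<Union>p\<in>C. {f (fst p)<..<f (snd p)})"
proof -
  let ?P = "\<lambda>u v. (\<exists>p\<in>C. {u..v} \<subseteq> {fst p<..<snd p}) \<and> q * (v - u) \<le> f v - f u"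
  have cov: "\<exists>u v. u \<le> x \<and> x \<le> v \<and> u < v \<and> v - u < d \<and> ?P u v" if "x \<in> A" "0 < d" for x d
  proof -
    obtain p where "p \<in> C" "x \<in> {fst p<..<snd p}" using AC \<open>x \<in> A\<close> by blast
    then have "small_intervals (\<lambda>u v. {u..v} \<subseteq> {fst p<..<snd p} \<and> q * (v - u) \<le> f v - f u) x"
      by (intro small_intervals_open steep \<open>x \<in> A\<close>) auto
    then show ?thesis using \<open>0 < d\<close> \<open>p \<in> C\<close> unfolding small_intervals_def by meson
  qed
  obtain D where D: "countable D" "\<forall>p\<in>D. fst p < snd p \<and> ?P (fst p) (snd p)"
    "pairwise (\<lambda>p q. disjnt {fst p..snd p} {fst q..snd q}) D"
    "negligible (A - (\<Union>p\<in>D. {fst p<..<snd p}))"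
    by (rule Vitali_covering_intervals[of A ?P, OF cov])
  have "emeasure lborel (\<Union>p\<in>D. {fst p<..<snd p}) = (\<integral>\<^sup>+p. ennreal (snd p - fst p) \<partial>count_space D)"
    using D by (intro emeasure_intervals) auto
  also have "\<dots> \<le> (\<integral>\<^sup>+p. ennreal (1/q) * ennreal (f (snd p) - f (fst p)) \<partial>count_space D)"
  proof (rule nn_integral_mono)
    fix p assume "p \<in> space (count_space D)"
    then have "fst p < snd p" "q * (snd p - fst p) \<le> f (snd p) - f (fst p)" using D(2) by auto
    then show "ennreal (snd p - fst p) \<le> ennreal (1/q) * ennreal (f (snd p) - f (fst p))"
      using \<open>0 < q\<close> \<open>mono f\<close> by (subst ennreal_mult[symmetric]) (auto simp: field_simps mono_def)
  qed
  also have "\<dots> = ennreal (1/q) * emeasure lborel (\<Union>p\<in>D. {f (fst p)<..<f (snd p)})"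
    using D \<open>mono f\<close> by (subst emeasure_mono_image_intervals) (auto simp: nn_integral_cmult)
  also have "\<dots> \<le> ennreal (1/q) * emeasure lborel (\<Union>p\<in>C. {f (fst p)<..<f (snd p)})"
  proof (intro mult_left_mono emeasure_mono subsetI)
    fix y assume "y \<in> (\<Union>p\<in>D. {f (fst p)<..<f (snd p)})"
    then obtain p where p: "p \<in> D" "f (fst p) < y" "y < f (snd p)" by auto
    then obtain c where c: "c \<in> C" "{fst p..snd p} \<subseteq> {fst c<..<snd c}" using D(2) by blast
    have "fst p < snd p" using D(2) p by blast
    then have "fst p \<in> {fst c<..<snd c}" "snd p \<in> {fst c<..<snd c}" by (intro subsetD[OF c(2)]; simp)+
    then have "fst c \<le> fst p" "snd p \<le> snd c" by auto
    then have "f (fst c) \<le> f (fst p)" "f (snd p) \<le> f (snd c)" using \<open>mono f\<close> by (auto simp: mono_def)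
    then show "y \<in> (\<Union>p\<in>C. {f (fst p)<..<f (snd p)})" using c(1) p by (intro UN_I[of c]) auto
  qed (auto intro!: borel_open)
  finally show ?thesis by (intro that[OF _ D(4)]) auto
qed

text \<open>The superset \<open>U \<union> (A - U)\<close> is measurable with the measure of
  \<open>U\<close>, and measurable supersets of small measure suffice, so nothing is asked of
  \<open>A\<close> itself.\<close>

lemma negligible_if_small_open_covers:
  fixes A :: "real set"
  assumes "\<And>e. 0 < e \<Longrightarrow> \<exists>U. open U \<and> negligible (A - U) \<and> emeasure lborel U \<le> ennreal e"
  shows "negligible A"
proof (subst negligible_outer_le, intro allI impI)
  fix e :: real assume "e > 0"
  then obtain U where U: "open U" "negligible (A - U)" "emeasure lborel U \<le> ennreal e"
    using assms by blast
  have Ul: "U \<in> lmeasurable" "measure lebesgue U \<le> e"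
    using U \<open>e > 0\<close> by (auto simp: fmeasurable_def measure_def enn2real_leI intro: order.strict_trans1)
  have "measure lebesgue (U \<union> (A - U)) = measure lebesgue U"
    using U Ul by (simp add: measure_Un_null_set negligible_iff_null_sets fmeasurableD del: Un_Diff_cancel)
  moreover have "U \<union> (A - U) \<in> lmeasurable"
    using Ul U(2) by (simp add: fmeasurable.Un negligible_imp_measurable del: Un_Diff_cancel)
  ultimately show "\<exists>T. A \<subseteq> T \<and> T \<in> lmeasurable \<and> measure lebesgue T \<le> e"
    using Ul by (intro exI[of _ "U \<union> (A - U)"]) auto
qed

lemma negligible_infinite_slope:
  fixes f :: "real \<Rightarrow> real"
  assumes "mono f" 
  shows "negligible {x. \<forall>q>0. small_intervals (\<lambda>u v. q * (v - u) \<le> f v - f u) x}" (is "negligible ?A")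
proof -
  have "negligible (?A \<inter> {- real k<..<real k})" (is "negligible ?B") for k
  proof (rule negligible_if_small_open_covers)
    fix e :: real assume "0 < e"
    define L where "L = f (real k) - f (- real k)"
    have L: "L \<ge> 0" using \<open>mono f\<close> by (auto simp: L_def mono_def)
    \<comment> \<open>This gives \<open>L / q < e\<close>; the summand 1 keeps \<open>q\<close>
      positive when \<open>L = 0\<close>.\<close>
    define q where "q = (L + 1) / e"
    have q: "q > 0" using L \<open>e > 0\<close> by (simp add: q_def)
    obtain U where U: "open U" "negligible (?B - U)"
    "emeasure lborel U \<le> ennreal (1/q) * emeasure lborel (\<Union>p\<in>{(- real k, real k)}. {f (fst p)<..<f (snd p)})"
      by (rule steep_cover[OF \<open>mono f\<close> q, of "?B" "{(- real k, real k)}"]) (use q in auto)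
    note U(3)
    also have "emeasure lborel (\<Union>p\<in>{(- real k, real k)}. {f (fst p)<..<f (snd p)}) = ennreal L"
      using L by (simp add: L_def)
    also have "ennreal (1/q) * ennreal L \<le> ennreal e"
      using L q \<open>e > 0\<close> by (subst ennreal_mult[symmetric]) (auto simp: q_def field_simps)
    finally show "\<exists>U. open U \<and> negligible (?B - U) \<and> emeasure lborel U \<le> ennreal e" using U by blast
  qed
  then have "negligible (\<Union>k. ?A \<inter> {- real k<..<real k})" by (intro negligible_countable_Union) auto
  then show ?thesis
  proof (rule negligible_subset, intro subsetI)
    fix x assume x: "x \<in> ?A"
    obtain k where "\<bar>x\<bar> < real k" using reals_Archimedean2 by blast
    then show "x \<in> (\<Union>k. ?A \<inter> {- real k<..<real k})" using x by (intro UN_I[of k]) auto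
  qed
qed

text \<open>Cover the set by disjoint intervals on which the slope is at most \<open>p\<close>, and refine to
  disjoint intervals on which it is at least \<open>q\<close>. The images under \<open>f\<close> of the finer intervals are
  disjoint and contained in those of the coarser ones, which compares the total lengths.\<close>

lemma slope_gap_step:
  fixes f :: "real \<Rightarrow> real"
  assumes "mono f" "0 < p" "p < q"
    and steep: "\<And>x. x \<in> A \<Longrightarrow> small_intervals (\<lambda>u v. q * (v - u) \<le> f v - f u) x"
    and flat: "\<And>x. x \<in> A \<Longrightarrow> small_intervals (\<lambda>u v. f v - f u \<le> p * (v - u)) x"
    and U: "open U" "negligible (A - U)"
  obtains V where "open V" "negligible (A - V)" "emeasure lborel V \<le> ennreal (p/q) * emeasure lborel U"
proof -
  let ?P = "\<lambda>u v. {u..v} \<subseteq> U \<and> f v - f u \<le> p * (v - u)"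
  have cov: "\<exists>u v. u \<le> x \<and> x \<le> v \<and> u < v \<and> v - u < d \<and> ?P u v" if "x \<in> A \<inter> U" "0 < d" for x d
    using small_intervals_open[OF flat U(1)] that unfolding small_intervals_def by blast
  obtain C where C: "countable C" "\<forall>p\<in>C. fst p < snd p \<and> ?P (fst p) (snd p)"
    "pairwise (\<lambda>p q. disjnt {fst p..snd p} {fst q..snd q}) C"
    "negligible (A \<inter> U - (\<Union>p\<in>C. {fst p<..<snd p}))"
    by (rule Vitali_covering_intervals[of "A \<inter> U" ?P, OF cov])
  define W where "W = (\<Union>p\<in>C. {fst p<..<snd p})"
  obtain V where V: "open V" "negligible (A \<inter> W - V)"
    "emeasure lborel V \<le> ennreal (1/q) * emeasure lborel (\<Union>p\<in>C. {f (fst p)<..<f (snd p)})"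
    by (rule steep_cover[OF \<open>mono f\<close>, of q "A \<inter> W" C]) (use assms W_def in auto)
  note V(3)
  also have "emeasure lborel (\<Union>p\<in>C. {f (fst p)<..<f (snd p)}) =
     (\<integral>\<^sup>+p. ennreal (f (snd p) - f (fst p)) \<partial>count_space C)"
    using C \<open>mono f\<close> by (intro emeasure_mono_image_intervals) auto
  also have "\<dots> \<le> (\<integral>\<^sup>+z. ennreal p * ennreal (snd z - fst z) \<partial>count_space C)"
    using C(2) assms(2) by (intro nn_integral_mono) (auto simp: ennreal_mult[symmetric] less_imp_le)
  also have "\<dots> = ennreal p * emeasure lborel W"
    unfolding W_def using C by (subst emeasure_intervals) (auto simp: nn_integral_cmult)
  also have "emeasure lborel W \<le> emeasure lborel U"
    using U(1) C(2) by (intro emeasure_mono) (fastforce simp: W_def intro: borel_open)+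
  finally have "emeasure lborel V \<le> ennreal (1/q) * (ennreal p * emeasure lborel U)"
    by (simp add: mult_left_mono)
  also have "\<dots> = ennreal (p/q) * emeasure lborel U"
    using assms(2,3) by (simp add: mult.assoc[symmetric] ennreal_mult[symmetric])
  finally have "emeasure lborel V \<le> ennreal (p/q) * emeasure lborel U" .
  moreover have "negligible (A - V)"
    using negligible_Un[OF U(2) negligible_Un[OF C(4) V(2)]]
    by (rule negligible_subset) (unfold W_def, blast)
  ultimately show ?thesis using that V by blast
qed

text \<open>Each use of \<open>slope_gap_step\<close> shrinks the bound on the covering open set by
  the factor \<open>p / q < 1\<close>, starting from an interval of length
  \<open>2 * real k\<close>. The geometric decay takes the place of the usual choice of an open set
  with nearly minimal outer measure.\<close>

lemma negligible_slope_gap: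
  fixes f :: "real \<Rightarrow> real"
  assumes "mono f" "0 < p" "p < q"
  shows "negligible {x. small_intervals (\<lambda>u v. q * (v - u) \<le> f v - f u) x \<and>
      small_intervals (\<lambda>u v. f v - f u \<le> p * (v - u)) x}" (is "negligible ?A")
proof -
  have "negligible (?A \<inter> {- real k<..<real k})" (is "negligible ?B") for k
  proof (rule negligible_if_small_open_covers)
    fix e :: real assume "0 < e"
    have *: "\<exists>U. open U \<and> negligible (?B - U) \<and> emeasure lborel U \<le> ennreal ((p/q)^m * (2 * real k))" for m
    proof (induction m)
      case 0
      then show ?case by (intro exI[of _ "{- real k<..<real k}"]) auto
    next
      case (Suc m)
      then obtain U where U: "open U" "negligible (?B - U)"
        "emeasure lborel U \<le> ennreal ((p/q)^m * (2 * real k))" by blast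
      obtain V where V: "open V" "negligible (?B - V)" "emeasure lborel V \<le> ennreal (p/q) * emeasure lborel U"
        by (rule slope_gap_step[OF assms _ _ U(1,2)]) auto
      note V(3)
      also have "ennreal (p/q) * emeasure lborel U \<le> ennreal (p/q) * ennreal ((p/q)^m * (2 * real k))"
        using U(3) by (intro mult_left_mono) auto
      also have "\<dots> = ennreal ((p/q)^Suc m * (2 * real k))"
        using assms by (subst ennreal_mult[symmetric]) (auto simp: mult_ac)
      finally show ?case using V by blast
    qed
    have "(\<lambda>m. (p/q)^m * (2 * real k)) \<longlonglongrightarrow> 0 * (2 * real k)"
      using assms by (intro tendsto_mult LIMSEQ_realpow_zero tendsto_const) auto
    then have "\<forall>\<^sub>F m in sequentially. (p/q)^m * (2 * real k) < e"
      using \<open>0 < e\<close> by (simp add: order_tendsto_iff)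
    then obtain m where "(p/q)^m * (2 * real k) < e" by (auto simp: eventually_sequentially)
    then have "ennreal ((p/q)^m * (2 * real k)) \<le> ennreal e" by (intro ennreal_leI) auto
    with *[of m] show "\<exists>U. open U \<and> negligible (?B - U) \<and> emeasure lborel U \<le> ennreal e"
      by (meson order.trans)
  qed
  then have "negligible (\<Union>k. ?A \<inter> {- real k<..<real k})" by (intro negligible_countable_Union) auto
  then show ?thesis
  proof (rule negligible_subset, intro subsetI)
    fix x assume x: "x \<in> ?A"
    obtain k where "\<bar>x\<bar> < real k" using reals_Archimedean2 by blast
    then show "x \<in> (\<Union>k. ?A \<inter> {- real k<..<real k})" using x by (intro UN_I[of k]) auto
  qed
qed

text \<open>The derivative is the lower derivative \<open>L = Sup B\<close>, where \<open>B\<close>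
  collects the lower bounds for the slopes of all sufficiently short intervals containing
  \<open>x\<close>. It is finite by \<open>fin\<close>, and \<open>gap\<close> forbids slopes that
  stay above \<open>L\<close>.\<close>

lemma differentiable_if_slopes:
  fixes f :: "real \<Rightarrow> real"
  assumes "mono f"
    and fin: "q0 > 0" "\<not> small_intervals (\<lambda>u v. q0 * (v - u) \<le> f v - f u) x"
    and gap: "\<And>p q. p \<in> \<rat> \<Longrightarrow> q \<in> \<rat> \<Longrightarrow> 0 < p \<Longrightarrow> p < q \<Longrightarrow>
      \<not> (small_intervals (\<lambda>u v. q * (v - u) \<le> f v - f u) x \<and> small_intervals (\<lambda>u v. f v - f u \<le> p * (v - u)) x)"
  shows "f differentiable (at x)"
proof -
  define B where "B = {p. \<not> small_intervals (\<lambda>u v. f v - f u < p * (v - u)) x}"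
  have B: "\<not> small_intervals (\<lambda>u v. f v - f u < p * (v - u)) x" if "p \<in> B" for p
    using that by (simp add: B_def)
  \<comment> \<open>This makes \<open>L\<close> nonnegative, so that rationals above
    \<open>L\<close> are positive, as \<open>gap\<close> requires.\<close>
  have "0 \<in> B" using \<open>mono f\<close> by (auto simp: B_def small_intervals_def mono_def not_less intro: exI[of _ 1])
  have "p \<le> q0" if "p \<in> B" for p
  proof (rule ccontr)
    assume "\<not> p \<le> q0"
    obtain d1 where d1: "d1 > 0" "\<And>u v. u \<le> x \<Longrightarrow> x \<le> v \<Longrightarrow> u < v \<Longrightarrow> v - u < d1 \<Longrightarrow> f v - f u < q0 * (v - u)"
      by (rule not_small_intervalsE[OF fin(2), unfolded not_le]) (rule that, assumption, blast)
    obtain d2 where d2: "d2 > 0" "\<And>u v. u \<le> x \<Longrightarrow> x \<le> v \<Longrightarrow> u < v \<Longrightarrow> v - u < d2 \<Longrightarrow> p * (v - u) \<le> f v - f u"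
      by (rule not_small_intervalsE[OF B[OF \<open>p \<in> B\<close>], unfolded not_less]) (rule that, assumption, blast)
    define h where "h = min d1 d2 / 2"
    have "h > 0" "h < d1" "h < d2" using d1(1) d2(1) by (auto simp: h_def)
    then have "f (x + h) - f x < q0 * h" "p * h \<le> f (x + h) - f x"
      using d1(2)[of x "x + h"] d2(2)[of x "x + h"] by simp_all
    then have "p * h < q0 * h" by linarith
    then show False using \<open>h > 0\<close> \<open>\<not> p \<le> q0\<close> by simp
  qed
  then have bdd: "bdd_above B" by (auto simp: bdd_above_def)
  define L where "L = Sup B"
  have L0: "L \<ge> 0" using \<open>0 \<in> B\<close> bdd by (simp add: L_def cSup_upper)
  have "\<exists>d>0. \<forall>u v. u \<le> x \<and> x \<le> v \<and> u < v \<and> v - u < d \<longrightarrow> \<bar>f v - f u - L * (v - u)\<bar> \<le> e * (v - u)"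
    if "e > 0" for e
  proof -
    obtain p0 where p0: "p0 \<in> B" "L - e < p0"
      using less_cSupD[of B "L - e"] \<open>0 \<in> B\<close> \<open>e > 0\<close> unfolding L_def by fastforce
    obtain p where p: "p \<in> \<rat>" "L < p" "p < L + e" using Rats_dense_in_real[of L "L+e"] \<open>e > 0\<close> by auto
    obtain q where q: "q \<in> \<rat>" "p < q" "q < L + e" using Rats_dense_in_real[OF p(3)] by auto
    \<comment> \<open>Slopes below \<open>p\<close> thus occur at every small scale, and
      \<open>gap\<close> excludes slopes of at least \<open>q\<close> at some scale. Together with
      the lower bound \<open>p0\<close>, all slopes near \<open>x\<close> are within
      \<open>e\<close> of \<open>L\<close>.\<close>
    have "p \<notin> B" using p(2) bdd cSup_upper[of p B] by (auto simp: L_def)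
    then have "small_intervals (\<lambda>u v. f v - f u \<le> p * (v - u)) x"
      unfolding B_def by (auto elim!: small_intervals_mono)
    then have nb: "\<not> small_intervals (\<lambda>u v. q * (v - u) \<le> f v - f u) x" using gap[OF p(1) q(1)] p q L0 by auto
    obtain d1 where d1: "d1 > 0" "\<And>u v. u \<le> x \<Longrightarrow> x \<le> v \<Longrightarrow> u < v \<Longrightarrow> v - u < d1 \<Longrightarrow> f v - f u < q * (v - u)"
      by (rule not_small_intervalsE[OF nb, unfolded not_le]) (rule that, assumption, blast)
    obtain d2 where d2: "d2 > 0" "\<And>u v. u \<le> x \<Longrightarrow> x \<le> v \<Longrightarrow> u < v \<Longrightarrow> v - u < d2 \<Longrightarrow> p0 * (v - u) \<le> f v - f u"
      by (rule not_small_intervalsE[OF B[OF p0(1)], unfolded not_less]) (rule that, assumption, blast)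
    show ?thesis
    proof (intro exI[of _ "min d1 d2"] conjI allI impI)
      fix u v assume *: "u \<le> x \<and> x \<le> v \<and> u < v \<and> v - u < min d1 d2"
      have "f v - f u < q * (v - u)" "p0 * (v - u) \<le> f v - f u" using d1(2)[of u v] d2(2)[of u v] * by auto
      moreover have "q * (v - u) \<le> (L + e) * (v - u)" "(L - e) * (v - u) \<le> p0 * (v - u)"
        using * q p0 by (auto intro!: mult_right_mono)
      ultimately show "\<bar>f v - f u - L * (v - u)\<bar> \<le> e * (v - u)" by (simp add: algebra_simps abs_le_iff)
    qed (use d1 d2 in auto)
  qed
  note * = this
  have "(f has_derivative (\<lambda>h. L * h)) (at x)"
    unfolding has_derivative_at_alt
  proof (intro conjI allI impI)
    fix e :: real assume "e > 0"
    from *[OF this] obtain d where d: "d > 0"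
      "\<And>u v. u \<le> x \<Longrightarrow> x \<le> v \<Longrightarrow> u < v \<Longrightarrow> v - u < d \<Longrightarrow> \<bar>f v - f u - L * (v - u)\<bar> \<le> e * (v - u)" by blast
    show "\<exists>d>0. \<forall>y. norm (y - x) < d \<longrightarrow> norm (f y - f x - L * (y - x)) \<le> e * norm (y - x)"
    proof (intro exI[of _ d] conjI allI impI)
      fix y assume y: "norm (y - x) < d"
      consider "y = x" | "y > x" | "y < x" by linarith
      then show "norm (f y - f x - L * (y - x)) \<le> e * norm (y - x)"
      proof cases
        case 3
        then have "\<bar>f x - f y - L * (x - y)\<bar> \<le> e * (x - y)" using d(2)[of y x] y by auto
        then show ?thesis using 3 by (simp add: algebra_simps abs_le_iff)
      qed (use d(2)[of x y] y in auto)
    qed (use d in auto)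
  qed (auto intro: bounded_linear_mult_right)
  then show ?thesis by (auto simp: differentiable_def)
qed

theorem mono_differentiable_ae:
  fixes f :: "real \<Rightarrow> real"
  assumes "mono f"
  shows "negligible {x. \<not> f differentiable (at x)}"
proof -
  define G where "G = (\<lambda>p q. {x. small_intervals (\<lambda>u v. q * (v - u) \<le> f v - f u) x \<and>
      small_intervals (\<lambda>u v. f v - f u \<le> p * (v - u)) x})"
  let ?I = "{x. \<forall>q>0. small_intervals (\<lambda>u v. q * (v - u) \<le> f v - f u) x}"
  \<comment> \<open>Rational pairs suffice to detect a gap and keep the union of null sets
    countable.\<close>
  define J where "J = {(p, q). p \<in> \<rat> \<and> q \<in> \<rat> \<and> (0::real) < p \<and> p < q}"
  have "countable J" 
    by (rule countable_subset[of _ "\<rat> \<times> \<rat>"]) (auto simp: J_def countable_rat)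
  then have "negligible (\<Union>(p, q)\<in>J. G p q)"
    using negligible_slope_gap[OF assms] by (intro negligible_countable_Union) (auto simp: J_def G_def)
  then have "negligible (?I \<union> (\<Union>(p, q)\<in>J. G p q))"
    using negligible_infinite_slope[OF assms] negligible_Un by blast
  then show ?thesis
  proof (rule negligible_subset, intro subsetI)
    fix x assume x: "x \<in> {x. \<not> f differentiable (at x)}"
    show "x \<in> ?I \<union> (\<Union>(p, q)\<in>J. G p q)"
    proof (rule ccontr)
      assume "x \<notin> ?I \<union> (\<Union>(p, q)\<in>J. G p q)"
      then have "f differentiable (at x)"
        using differentiable_if_slopes[OF assms] unfolding J_def G_def by blast
      then show False using x by simp
    qed
  qed
qed

lemma mono_on_differentiable_ae:
  fixes f :: "real \<Rightarrow> real"
  assumes "mono_on {a..b} f"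
  shows "negligible {x\<in>{a<..<b}. \<not> f differentiable (at x)}"
proof (cases "a < b")
  case True
  \<comment> \<open>Clamping the argument extends \<open>f\<close> to a monotone function on the
    line that agrees with \<open>f\<close> near every interior point.\<close>
  define g where "g = (\<lambda>x. f (max a (min b x)))"
  have "mono g"
    unfolding g_def using True by (intro monoI mono_onD[OF assms]) auto
  then have "negligible {x. \<not> g differentiable (at x)}" by (rule mono_differentiable_ae)
  then show ?thesis
  proof (rule negligible_subset, safe)
    fix x assume x: "x \<in> {a<..<b}" "\<not> f differentiable (at x)" "g differentiable (at x)"
    obtain D where "(g has_derivative D) (at x)" using x by (auto simp: differentiable_def)
    then have "(f has_derivative D) (at x)"
      by (rule has_derivative_transform_within_open[of _ _ _ _ "{a<..<b}"]) (use x in \<open>auto simp: g_def\<close>)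
    then show False using x by (auto simp: differentiable_def)
  qed
qed auto

section \<open>Differentiability of generalised absolutely continuous functions\<close>

text \<open>Finite sets of pairs replace numbered families, and arbitrary selections
  \<open>\<sigma>\<close>, \<open>\<tau>\<close> of points replace the suprema, so that all later
  sums are real.\<close>

lemma AC_star_onE:
  assumes "AC_star_on E F" "0 < e"
  obtains \<eta> where "0 < \<eta>"
    "\<forall>Q \<sigma> \<tau>. finite Q \<longrightarrow> (\<forall>p\<in>Q. fst p \<in> E \<and> snd p \<in> E \<and> fst p \<le> snd p) \<longrightarrow>
       pairwise (\<lambda>p q. disjnt {fst p<..<snd p} {fst q<..<snd q}) Q \<longrightarrow> (\<Sum>p\<in>Q. snd p - fst p) < \<eta> \<longrightarrow>
       (\<forall>p\<in>Q. \<sigma> p \<in> {fst p..snd p} \<and> \<tau> p \<in> {fst p..snd p}) \<longrightarrow>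
       (\<Sum>p\<in>Q. \<bar>F (\<sigma> p) - F (\<tau> p)\<bar>) < e"
proof -
  from assms obtain \<eta> where \<eta>: "0 < \<eta>" "\<forall>(N::nat) c d.
      (\<forall>i<N. c i \<in> E \<and> d i \<in> E \<and> c i \<le> d i) \<and> disjoint_family_on (\<lambda>i. {c i<..<d i}) {..<N} \<and>
      (\<Sum>i<N. d i - c i) < \<eta> \<longrightarrow>
      (\<Sum>i<N. SUP s\<in>{c i..d i}. SUP t\<in>{c i..d i}. ennreal \<bar>F s - F t\<bar>) < ennreal e"
    unfolding AC_star_on_def by meson
  show ?thesis
  proof (rule that[OF \<eta>(1)], intro allI impI)
    fix Q \<sigma> \<tau>
    assume Q: "finite Q" "\<forall>p\<in>Q. fst p \<in> E \<and> snd p \<in> E \<and> fst p \<le> snd p"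
       "pairwise (\<lambda>p q. disjnt {fst p<..<snd p} {fst q<..<snd q}) Q" "(\<Sum>p\<in>Q. snd p - fst p) < \<eta>"
      and sel: "\<forall>p\<in>Q. \<sigma> p \<in> {fst p..snd p} \<and> \<tau> p \<in> {fst p..snd p}"
    let ?S = "\<lambda>p. SUP s\<in>{fst p..snd p}. SUP t\<in>{fst p..snd p}. ennreal \<bar>F s - F t\<bar>"
    obtain h where h: "bij_betw h {..<card Q} Q"
      using ex_bij_betw_nat_finite[OF Q(1)] by (auto simp: atLeast0LessThan)
    have hQ: "h i \<in> Q" if "i < card Q" for i using h that by (auto simp: bij_betw_def)
    have "disjoint_family_on (\<lambda>i. {fst (h i)<..<snd (h i)}) {..<card Q}"
      unfolding disjoint_family_on_def
    proof (intro ballI impI)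
      fix i j assume ij: "i \<in> {..<card Q}" "j \<in> {..<card Q}" "i \<noteq> j"
      then have "h i \<noteq> h j" using h by (auto simp: bij_betw_def inj_on_def)
      then show "{fst (h i)<..<snd (h i)} \<inter> {fst (h j)<..<snd (h j)} = {}"
        using Q(3) hQ ij by (auto simp: pairwise_def disjnt_def)
    qed
    moreover have "(\<Sum>i<card Q. snd (h i) - fst (h i)) < \<eta>"
      using Q(4) sum.reindex_bij_betw[OF h, of "\<lambda>p. snd p - fst p"] by simp
    ultimately have "(\<Sum>i<card Q. ?S (h i)) < ennreal e"
      using \<eta>(2)[rule_format, of "card Q" "\<lambda>i. fst (h i)" "\<lambda>i. snd (h i)"] Q(2) hQ by blast
    then have "(\<Sum>p\<in>Q. ?S p) < ennreal e"
      using sum.reindex_bij_betw[OF h, of ?S] by simp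
    moreover have "(\<Sum>p\<in>Q. ennreal \<bar>F (\<sigma> p) - F (\<tau> p)\<bar>) \<le> (\<Sum>p\<in>Q. ?S p)"
      using sel by (intro sum_mono) (meson SUP_upper2 SUP_upper)
    ultimately have "ennreal (\<Sum>p\<in>Q. \<bar>F (\<sigma> p) - F (\<tau> p)\<bar>) < ennreal e" by (simp add: sum_ennreal)
    then show "(\<Sum>p\<in>Q. \<bar>F (\<sigma> p) - F (\<tau> p)\<bar>) < e"
      by (subst (asm) ennreal_less_iff) (auto intro: sum_nonneg)
  qed
qed

lemma sum_lengths_le_measure:
  fixes Q :: "(real \<times> real) set"
  assumes "finite Q" "\<And>p. p \<in> Q \<Longrightarrow> fst p \<le> snd p \<and> {fst p<..<snd p} \<subseteq> U"
    "pairwise (\<lambda>p q. disjnt {fst p<..<snd p} {fst q<..<snd q}) Q" "U \<in> lmeasurable"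
  shows "(\<Sum>p\<in>Q. snd p - fst p) \<le> measure lebesgue U"
proof -
  have "(\<Sum>p\<in>Q. snd p - fst p) = (\<Sum>p\<in>Q. measure lebesgue {fst p<..<snd p})"
    using assms(2) by (intro sum.cong) auto
  also have "\<dots> = measure lebesgue (\<Union>p\<in>Q. {fst p<..<snd p})"
    using assms by (intro measure_finite_Union[symmetric])
      (auto simp: disjoint_family_on_def pairwise_def disjnt_def)
  also have "\<dots> \<le> measure lebesgue U"
    using assms by (intro measure_mono_fmeasurable sets.finite_UN) auto
  finally show ?thesis .
qed

text \<open>The gaps to the right of distinct such points are disjoint nonempty open intervals, and
  the line has room for only countably many of them.\<close>

lemma countable_right_isolated:
  fixes E :: "real set"
  shows "countable {x\<in>E. \<exists>r>0. E \<inter> {x<..<x + r} = {}}" (is "countable ?R")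
proof -
  obtain r where r: "r x > 0" "E \<inter> {x<..<x + r x} = {}" if "x \<in> ?R" for x
    by atomize_elim (use bchoice[of ?R "\<lambda>x r. r > 0 \<and> E \<inter> {x<..<x + r} = {}"] in blast)
  let ?I = "\<lambda>x. {x<..<x + r x}"
  have dis: "disjnt (?I x) (?I y)" if "x \<in> ?R" "y \<in> ?R" "x < y" for x y
  proof -
    have "y \<notin> ?I x" using r(2)[OF that(1)] that(2) by blast
    then show ?thesis using that(3) by (auto simp: disjnt_iff)
  qed
  have ne: "?I x \<noteq> {}" if "x \<in> ?R" for x using r(1)[OF that] by auto
  have "inj_on ?I ?R"
  proof (rule inj_onI)
    fix x y assume xy: "x \<in> ?R" "y \<in> ?R" "?I x = ?I y"
    show "x = y"
    proof (rule linorder_cases[of x y])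
      assume "x < y"
      then show ?thesis using dis[OF xy(1,2)] xy(3) ne[OF xy(2)] by (simp add: disjnt_def)
    next
      assume "y < x"
      then show ?thesis using dis[OF xy(2,1)] xy(3) ne[OF xy(2)] by (simp add: disjnt_def)
    qed
  qed
  moreover have "countable (?I ` ?R)"
  proof (rule countable_disjoint_open_subsets)
    show "pairwise disjnt (?I ` ?R)"
      unfolding pairwise_image
    proof (intro pairwiseI)
      fix x y assume "x \<in> ?R" "y \<in> ?R" "x \<noteq> y"
      then show "?I x \<noteq> ?I y \<longrightarrow> disjnt (?I x) (?I y)"
        using dis[of x y] dis[of y x] disjnt_sym by (cases x y rule: linorder_cases) blast+
    qed
  qed auto
  ultimately show ?thesis by (rule countable_image_inj_on[rotated])
qed

lemma countable_left_isolated: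
  fixes E :: "real set"
  shows "countable {x\<in>E. \<exists>r>0. E \<inter> {x - r<..<x} = {}}" (is "countable ?L")
proof -
  have "?L \<subseteq> uminus ` {x\<in>uminus ` E. \<exists>r>0. uminus ` E \<inter> {x<..<x + r} = {}}"
  proof
    fix x assume "x \<in> ?L"
    then obtain r where r: "x \<in> E" "r > 0" "E \<inter> {x - r<..<x} = {}" by blast
    have "uminus ` E \<inter> {-x<..<-x + r} = {}" using r(3) by force
    then show "x \<in> uminus ` {x\<in>uminus ` E. \<exists>r>0. uminus ` E \<inter> {x<..<x + r} = {}}"
      using r by (intro image_eqI[of _ _ "-x"]) auto
  qed
  then show ?thesis by (rule countable_subset) (intro countable_image countable_right_isolated)
qed

section \<open>Differentiability by squeezing\<close>

text \<open>\<open>U - L\<close> is minimal at \<open>x\<close>, so \<open>U\<close> and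
  \<open>L\<close> have the same derivative there. Comparing the quotients of \<open>K\<close> and
  \<open>L\<close> in absolute value avoids separate cases for the sign of the increment.\<close>

lemma differentiable_sandwich:
  fixes K U L :: "real \<Rightarrow> real"
  assumes "open S" "x \<in> S" "\<And>t. t \<in> S \<Longrightarrow> L t \<le> K t \<and> K t \<le> U t" "L x = K x" "U x = K x"
    and "U differentiable (at x)" "L differentiable (at x)"
  shows "K differentiable (at x)"
proof -
  obtain u l where u: "(U has_real_derivative u) (at x)" and l: "(L has_real_derivative l) (at x)"
    using assms(6,7) by (auto simp: real_differentiable_def)
  obtain d where d: "d > 0" "ball x d \<subseteq> S" using assms(1,2) open_contains_ball by blast
  have "((\<lambda>t. U t - L t) has_real_derivative (u - l)) (at x)" using u l by (rule DERIV_diff)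
  moreover have "\<forall>y. \<bar>x - y\<bar> < d \<longrightarrow> U x - L x \<le> U y - L y"
  proof (intro allI impI)
    fix y assume "\<bar>x - y\<bar> < d"
    then have "y \<in> S" using d by (auto simp: dist_real_def)
    then show "U x - L x \<le> U y - L y" using assms(3)[of y] assms(4,5) by auto
  qed
  ultimately have "u - l = 0" using d(1) by (metis (lifting) DERIV_local_min)
  then have "u = l" by simp
  have L: "(\<lambda>h. (L (x + h) - L x) / h) \<midarrow>0\<rightarrow> l" and U: "(\<lambda>h. (U (x + h) - U x) / h) \<midarrow>0\<rightarrow> l"
    using u l \<open>u = l\<close> by (auto simp: DERIV_def)
  have "(\<lambda>h. (K (x + h) - K x) / h - (L (x + h) - L x) / h) \<midarrow>0\<rightarrow> 0"
  proof (rule Lim_null_comparison)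
    show "(\<lambda>h. \<bar>(U (x + h) - U x) / h - (L (x + h) - L x) / h\<bar>) \<midarrow>0\<rightarrow> 0"
      using tendsto_diff[OF U L] by (intro tendsto_rabs_zero) simp
    show "\<forall>\<^sub>F h in at 0. norm ((K (x + h) - K x) / h - (L (x + h) - L x) / h)
        \<le> \<bar>(U (x + h) - U x) / h - (L (x + h) - L x) / h\<bar>"
      unfolding eventually_at
    proof (intro exI[of _ d] conjI ballI impI)
      fix h :: real assume h: "h \<noteq> 0 \<and> dist h 0 < d"
      then have "x + h \<in> S" using d by (auto simp: dist_real_def)
      then have *: "0 \<le> K (x + h) - L (x + h)" "K (x + h) - L (x + h) \<le> U (x + h) - L (x + h)"
        using assms(3) by auto
      have "norm ((K (x + h) - K x) / h - (L (x + h) - L x) / h) = \<bar>K (x + h) - L (x + h)\<bar> / \<bar>h\<bar>"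
        using assms(4) by (simp add: diff_divide_distrib[symmetric])
      also have "\<dots> \<le> \<bar>U (x + h) - L (x + h)\<bar> / \<bar>h\<bar>"
        using * by (intro divide_right_mono) auto
      also have "\<dots> = \<bar>(U (x + h) - U x) / h - (L (x + h) - L x) / h\<bar>"
        using assms(4,5) by (simp add: diff_divide_distrib[symmetric])
      finally show "norm ((K (x + h) - K x) / h - (L (x + h) - L x) / h)
        \<le> \<bar>(U (x + h) - U x) / h - (L (x + h) - L x) / h\<bar>" .
    qed (use d in auto)
  qed
  from tendsto_add[OF this L] have "(\<lambda>h. (K (x + h) - K x) / h) \<midarrow>0\<rightarrow> l" by simp
  then show ?thesis by (auto simp: real_differentiable_def DERIV_def)
qed

text \<open>Extending \<open>V\<close> from \<open>E\<close> to monotone functions \<open>Vm \<le> Vp\<close>, the function \<open>K = F + Vm + Vp\<close> satisfies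
  \<open>K x \<le> K t \<le> K y\<close> for \<open>x \<le> t \<le> y\<close> with \<open>x\<close>, \<open>y\<close> in \<open>E\<close>; a single copy of \<open>V\<close> would not suffice when \<open>t\<close>
  lies in a gap of \<open>E\<close>. Hence the increasing majorant and minorant of \<open>K\<close> agree with \<open>K\<close> on \<open>E\<close>.\<close>

lemma differentiable_ae_if_osc_dominated:
  fixes F V :: "real \<Rightarrow> real"
  assumes "x0 \<in> E" "y0 \<in> E"
    and osc: "\<And>x y s t. \<lbrakk>x \<in> E; y \<in> E; x0 \<le> x; x \<le> y; y \<le> y0; s \<in> {x..y}; t \<in> {x..y}\<rbrakk>
      \<Longrightarrow> \<bar>F s - F t\<bar> \<le> V y - V x"
  shows "negligible {x \<in> E \<inter> {x0<..<y0}. \<not> F differentiable (at x)}"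
proof -
  define A where "A = E \<inter> {x0..y0}"
  have osc: "\<bar>F s - F t\<bar> \<le> V y - V x" if "x \<in> A" "y \<in> A" "x \<le> y" "s \<in> {x..y}" "t \<in> {x..y}" for x y s t
    using osc[of x y s t] that by (auto simp: A_def)
  have Vmono: "V x \<le> V y" if "x \<in> A" "y \<in> A" "x \<le> y" for x y
    using osc[of x y x x] that by auto
  show ?thesis
  proof (cases "x0 < y0")
    case True
    have A0: "x0 \<in> A" "y0 \<in> A" using assms(1,2) True by (auto simp: A_def)
    have Ai: "x0 \<le> x" "x \<le> y0" if "x \<in> A" for x using that by (auto simp: A_def)
    define Vm where "Vm = (\<lambda>t. Sup (V ` {x\<in>A. x \<le> t}))"
    define Vp where "Vp = (\<lambda>t. Inf (V ` {x\<in>A. t \<le> x}))"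
    define K where "K = (\<lambda>t. F t + Vm t + Vp t)"
    define Up where "Up = (\<lambda>t. Sup (K ` {x0..t}))"
    define Lo where "Lo = (\<lambda>t. Inf (K ` {t..y0}))"
    have bV: "bdd_above (V ` {x\<in>A. x \<le> t})" "bdd_below (V ` {x\<in>A. t \<le> x})" for t
      using Vmono A0 Ai by (auto intro!: bdd_aboveI[of _ "V y0"] bdd_belowI[of _ "V x0"])
    have Vm_ge: "V x \<le> Vm t" if "x \<in> A" "x \<le> t" for x t
      unfolding Vm_def using that by (intro cSup_upper bV) auto
    have Vp_le: "Vp t \<le> V x" if "x \<in> A" "t \<le> x" for x t
      unfolding Vp_def using that by (intro cInf_lower bV) auto
    have Vm_le: "Vm t \<le> c" if "x0 \<le> t" "\<And>x. x \<in> A \<Longrightarrow> x \<le> t \<Longrightarrow> V x \<le> c" for c t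
      unfolding Vm_def using that A0 by (intro cSup_least) auto
    have Vp_ge: "c \<le> Vp t" if "t \<le> y0" "\<And>x. x \<in> A \<Longrightarrow> t \<le> x \<Longrightarrow> c \<le> V x" for c t
      unfolding Vp_def using that A0 by (intro cInf_greatest) auto
    have VA: "Vm x = V x" "Vp x = V x" if "x \<in> A" for x
      using that by (auto intro!: antisym Vm_ge Vp_le Vm_le Vp_ge Vmono Ai)
    have Kx: "K x = F x + 2 * V x" if "x \<in> A" for x using VA[OF that] by (simp add: K_def)
    have K_ge: "K x \<le> K t" if "x \<in> A" "x \<le> t" "t \<le> y0" for x t
    proof -
      \<comment> \<open>For \<open>y\<close> in \<open>A\<close> beyond \<open>t\<close>, both
        \<open>x\<close> and \<open>t\<close> lie in \<open>{x..y}\<close>, so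
        \<open>F x - F t \<le> V y - V x\<close>. Adding \<open>V x \<le> Vm t\<close> gives
        \<open>F x + 2 * V x \<le> K t\<close>.\<close>
      have "V x + F x - F t \<le> Vp t"
        using osc[OF that(1), of _ x t] that(2) by (intro Vp_ge that) (force simp: abs_le_iff)
      then show ?thesis using Vm_ge[OF that(1,2)] Kx[OF that(1)] by (simp add: K_def)
    qed
    have K_le: "K t \<le> K y" if "y \<in> A" "t \<le> y" "x0 \<le> t" for y t
    proof -
      have "Vm t \<le> V y + F y - F t"
        using osc[OF _ that(1), of _ y t] that(2) by (intro Vm_le that) (force simp: abs_le_iff)
      then show ?thesis using Vp_le[OF that(1,2)] Kx[OF that(1)] by (simp add: K_def)
    qed
    have bK: "bdd_above (K ` {x0..t})" if "t \<le> y0" for t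
      using K_le[OF A0(2)] that by (intro bdd_aboveI[of _ "K y0"]) auto
    have bK': "bdd_below (K ` {t..y0})" if "x0 \<le> t" for t
      using K_ge[OF A0(1)] that by (intro bdd_belowI[of _ "K x0"]) auto
    have UpK: "K t \<le> Up t" if "t \<in> {x0..y0}" for t
      unfolding Up_def using that by (intro cSup_upper bK) auto
    have LoK: "Lo t \<le> K t" if "t \<in> {x0..y0}" for t
      unfolding Lo_def using that by (intro cInf_lower bK') auto
    have UpA: "Up x = K x" if "x \<in> A" for x
      using that Ai[OF that] K_le[OF that] unfolding Up_def by (intro cSup_eq_maximum) auto
    have LoA: "Lo x = K x" if "x \<in> A" for x
      using that Ai[OF that] K_ge[OF that] unfolding Lo_def by (intro cInf_eq_minimum) auto
    have "mono_on {x0..y0} Vm"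
      unfolding Vm_def using A0 by (intro mono_onI cSup_subset_mono bV) auto
    moreover have "mono_on {x0..y0} Vp"
      unfolding Vp_def using A0 by (intro mono_onI cInf_superset_mono bV) auto
    moreover have "mono_on {x0..y0} Up"
      unfolding Up_def by (intro mono_onI cSup_subset_mono bK) auto
    moreover have "mono_on {x0..y0} Lo"
      unfolding Lo_def by (intro mono_onI cInf_superset_mono bK') auto
    ultimately have "negligible (
       ({x\<in>{x0<..<y0}. \<not> Vm differentiable (at x)} \<union> {x\<in>{x0<..<y0}. \<not> Vp differentiable (at x)})
     \<union> ({x\<in>{x0<..<y0}. \<not> Up differentiable (at x)} \<union> {x\<in>{x0<..<y0}. \<not> Lo differentiable (at x)}))"
      by (intro negligible_Un mono_on_differentiable_ae)
    then show ?thesis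
    proof (rule negligible_subset, intro subsetI)
      fix x assume "x \<in> {x \<in> E \<inter> {x0<..<y0}. \<not> F differentiable (at x)}"
      then have x: "x \<in> A" "x \<in> {x0<..<y0}" "\<not> F differentiable (at x)" by (auto simp: A_def)
      show "x \<in> ({x\<in>{x0<..<y0}. \<not> Vm differentiable (at x)} \<union> {x\<in>{x0<..<y0}. \<not> Vp differentiable (at x)})
        \<union> ({x\<in>{x0<..<y0}. \<not> Up differentiable (at x)} \<union> {x\<in>{x0<..<y0}. \<not> Lo differentiable (at x)})"
        (is "x \<in> ?N")
      proof (rule ccontr)
        assume "x \<notin> ?N"
        then have d: "Vm differentiable (at x)" "Vp differentiable (at x)"
          "Up differentiable (at x)" "Lo differentiable (at x)" using x(2) by auto
        have "K differentiable (at x)"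
          by (rule differentiable_sandwich[of "{x0<..<y0}" x Lo K Up])
            (use x d UpK LoK UpA LoA in auto)
        then have "(\<lambda>t. K t - Vm t - Vp t) differentiable (at x)"
          using d by (intro differentiable_diff)
        then show False using x(3) by (simp add: K_def)
      qed
    qed
  qed auto
qed

text \<open>AC_* with bound 1 makes the variation function \<open>V\<close> finite between points of
  \<open>E\<close> closer than \<open>\<eta>\<close>, and appending \<open>{x..y}\<close> to a
  family that ends at \<open>x\<close> shows that \<open>V\<close> dominates oscillations.
  Lindelof's theorem reduces the resulting open intervals to countably many null sets of exceptions;
  the points outside all of them are isolated from one side.\<close>

lemma AC_star_on_differentiable_ae:
  assumes "AC_star_on E F"
  shows "negligible {x\<in>E. \<not> F differentiable (at x)}"
proof -
  obtain \<eta> where \<eta>: "0 < \<eta>" and AC: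
    "\<forall>Q \<sigma> \<tau>. finite Q \<longrightarrow> (\<forall>p\<in>Q. fst p \<in> E \<and> snd p \<in> E \<and> fst p \<le> snd p) \<longrightarrow>
       pairwise (\<lambda>p q. disjnt {fst p<..<snd p} {fst q<..<snd q}) Q \<longrightarrow> (\<Sum>p\<in>Q. snd p - fst p) < \<eta> \<longrightarrow>
       (\<forall>p\<in>Q. \<sigma> p \<in> {fst p..snd p} \<and> \<tau> p \<in> {fst p..snd p}) \<longrightarrow>
       (\<Sum>p\<in>Q. \<bar>F (\<sigma> p) - F (\<tau> p)\<bar>) < 1"
    by (rule AC_star_onE[OF assms zero_less_one])
  have local: "negligible {x \<in> E \<inter> {x0<..<y0}. \<not> F differentiable (at x)}"
    if xy: "x0 \<in> E" "y0 \<in> E" "y0 - x0 < \<eta>" for x0 y0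
  proof -
    define adm where "adm = (\<lambda>x Q \<sigma> \<tau>. finite Q \<and>
        (\<forall>p\<in>Q. fst p \<in> E \<and> snd p \<in> E \<and> x0 \<le> fst p \<and> fst p < snd p \<and> snd p \<le> x \<and>
          \<sigma> p \<in> {fst p..snd p} \<and> \<tau> p \<in> {fst p..snd p}) \<and>
        pairwise (\<lambda>p q. disjnt {fst p<..<snd p} {fst q<..<snd q}) Q)"
    define W where "W = (\<lambda>x. {(\<Sum>p\<in>Q. \<bar>F (\<sigma> p) - F (\<tau> p)\<bar>) | Q \<sigma> \<tau>. adm x Q \<sigma> \<tau>})"
    define V where "V = (\<lambda>x. Sup (W x))"
    have V_eq: "V x = Sup (W x)" for x by (simp add: V_def)
    have W0: "0 \<in> W x" for x
      unfolding W_def by (intro CollectI exI[of _ "{}"]) (auto simp: adm_def)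
    have W1: "w \<le> 1" if "w \<in> W x" "x \<le> y0" for w x
    proof -
      obtain Q \<sigma> \<tau> where Q: "adm x Q \<sigma> \<tau>" and w: "w = (\<Sum>p\<in>Q. \<bar>F (\<sigma> p) - F (\<tau> p)\<bar>)"
        using \<open>w \<in> W x\<close> by (auto simp: W_def)
      have "(\<Sum>p\<in>Q. snd p - fst p) < \<eta>"
      proof (cases "Q = {}")
        case False
        have "(\<Sum>p\<in>Q. snd p - fst p) \<le> measure lebesgue {x0..y0}"
          using Q that(2) unfolding adm_def by (intro sum_lengths_le_measure) fastforce+
        moreover have "x0 \<le> y0" using Q that(2) False unfolding adm_def by fastforce
        ultimately show ?thesis using xy by simp
      qed (use \<eta> in auto)
      then have "w < 1" unfolding w using Q unfolding adm_def by (intro AC[rule_format]) (auto simp: less_imp_le)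
      then show ?thesis by simp
    qed
    then have bW: "bdd_above (W x)" if "x \<le> y0" for x using that by (auto simp: bdd_above_def)
    have "\<bar>F s - F t\<bar> \<le> V y - V x"
      if *: "x \<in> E" "y \<in> E" "x0 \<le> x" "x \<le> y" "y \<le> y0" "s \<in> {x..y}" "t \<in> {x..y}" for x y s t
    proof (cases "x = y")
      case False
      then have "x < y" using * by simp
      have "w + \<bar>F s - F t\<bar> \<le> V y" if "w \<in> W x" for w
        unfolding V_def
      proof (rule cSup_upper[OF _ bW[OF \<open>y \<le> y0\<close>]])
        obtain Q \<sigma> \<tau> where Q: "adm x Q \<sigma> \<tau>" and w: "w = (\<Sum>p\<in>Q. \<bar>F (\<sigma> p) - F (\<tau> p)\<bar>)"
          using \<open>w \<in> W x\<close> by (auto simp: W_def)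
        \<comment> \<open>All intervals of \<open>Q\<close> end at or before \<open>x\<close>, so
          the appended one is new and does not overlap them; the selections change only
          there.\<close>
        have new: "(x, y) \<notin> Q" using Q \<open>x < y\<close> by (auto simp: adm_def)
        let ?\<sigma> = "\<sigma>((x,y) := s)" and ?\<tau> = "\<tau>((x,y) := t)"
        have adm: "adm y (insert (x, y) Q) ?\<sigma> ?\<tau>"
          unfolding adm_def
        proof (intro conjI)
          show "pairwise (\<lambda>p q. disjnt {fst p<..<snd p} {fst q<..<snd q}) (insert (x, y) Q)"
            using Q by (fastforce simp: adm_def pairwise_insert disjnt_iff)
        qed (use Q new * \<open>x < y\<close> in \<open>auto simp: adm_def; fastforce\<close>)+
        have sum_eq: "(\<Sum>p\<in>insert (x, y) Q. \<bar>F (?\<sigma> p) - F (?\<tau> p)\<bar>) = w + \<bar>F s - F t\<bar>"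
        proof -
          have "(\<Sum>p\<in>Q. \<bar>F (?\<sigma> p) - F (?\<tau> p)\<bar>) = w"
            unfolding w using new by (intro sum.cong) auto
          then show ?thesis using new Q by (simp add: adm_def)
        qed
        show "w + \<bar>F s - F t\<bar> \<in> W y" unfolding W_def
          by (intro CollectI exI conjI, rule sum_eq[symmetric], rule adm)
      qed
      then have "V x \<le> V y - \<bar>F s - F t\<bar>"
        unfolding V_eq[of x] using W0 by (intro cSup_least) (auto simp: le_diff_eq)
      then show ?thesis by simp
    qed (use * in auto)
    then show ?thesis by (intro differentiable_ae_if_osc_dominated[of _ _ _ _ V] xy)
  qed
  define \<I> where "\<I> = {{x0<..<y0} | x0 y0. x0 \<in> E \<and> y0 \<in> E \<and> y0 - x0 < \<eta>}"
  have op: "open I" if "I \<in> \<I>" for I using that by (auto simp: \<I>_def)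
  obtain \<I>' where \<I>': "\<I>' \<subseteq> \<I>" "countable \<I>'" "\<Union>\<I>' = \<Union>\<I>"
    by (rule Lindelof[of \<I>, OF op])
  define N where "N = (\<Union>I\<in>\<I>'. {x \<in> E \<inter> I. \<not> F differentiable (at x)})"
  let ?R = "{x\<in>E. \<exists>r>0. E \<inter> {x<..<x + r} = {}}" and ?L = "{x\<in>E. \<exists>r>0. E \<inter> {x - r<..<x} = {}}"
  have "negligible N"
    unfolding N_def using \<I>'(1,2) local by (intro negligible_countable_Union) (auto simp: \<I>_def)
  moreover have "negligible (?R \<union> ?L)"
    unfolding negligible_iff_null_sets
    by (intro null_sets_completionI countable_imp_null_set_lborel)
      (simp add: countable_right_isolated countable_left_isolated)
  ultimately have "negligible (N \<union> (?R \<union> ?L))" by (rule negligible_Un)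
  then show ?thesis
  proof (rule negligible_subset, intro subsetI)
    fix x assume x: "x \<in> {x\<in>E. \<not> F differentiable (at x)}"
    show "x \<in> N \<union> (?R \<union> ?L)"
    proof (rule ccontr)
      assume "x \<notin> N \<union> (?R \<union> ?L)"
      \<comment> \<open>The radius \<open>\<eta>/2\<close> keeps the neighbours on the two sides of
        \<open>x\<close> closer than \<open>\<eta>\<close> to each other.\<close>
      then have nN: "x \<notin> N" and "E \<inter> {x<..<x + \<eta>/2} \<noteq> {}" "E \<inter> {x - \<eta>/2<..<x} \<noteq> {}"
        using x \<eta> half_gt_zero by blast+
      then obtain x0 y0 where "x0 \<in> E" "y0 \<in> E" "x0 \<in> {x - \<eta>/2<..<x}" "y0 \<in> {x<..<x + \<eta>/2}" by blast
      moreover from this have "{x0<..<y0} \<in> \<I>"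
        unfolding \<I>_def by (intro CollectI exI[of _ x0] exI[of _ y0]) auto
      ultimately have "x \<in> \<Union>\<I>" by (intro UnionI[of "{x0<..<y0}"]) auto
      then obtain I where "I \<in> \<I>'" "x \<in> I" using \<I>'(3) by blast
      then show False using nN x unfolding N_def by blast
    qed
  qed
qed

section \<open>The fundamental theorem of calculus\<close>

text \<open>The pairs are intervals whose left endpoint is the tag. Intervals with the tag inside are cut at
  the tag, and left halves are treated as right halves of the reflected function.\<close>

definition null_right_variation :: "real set \<Rightarrow> (real \<Rightarrow> real) \<Rightarrow> real set \<Rightarrow> bool" where
  "null_right_variation S F A \<longleftrightarrow> (\<forall>e>0. \<exists>\<delta>. (\<forall>x. 0 < \<delta> x) \<and>
    (\<forall>P. finite P \<longrightarrow> (\<forall>p\<in>P. fst p \<in> A \<and> snd p \<in> S \<and> fst p < snd p \<and> snd p < fst p + \<delta> (fst p)) \<longrightarrow>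
       pairwise (\<lambda>p q. disjnt {fst p<..<snd p} {fst q<..<snd q}) P \<longrightarrow>
       (\<Sum>p\<in>P. \<bar>F (snd p) - F (fst p)\<bar>) \<le> e))"

lemma null_right_variation_subset:
  assumes "null_right_variation S F B" "A \<subseteq> B"
  shows "null_right_variation S F A"
  unfolding null_right_variation_def
proof (intro allI impI)
  fix e :: real assume "0 < e"
  then obtain \<delta> where \<delta>: "\<forall>x. 0 < \<delta> x"
    "\<forall>P. finite P \<longrightarrow> (\<forall>p\<in>P. fst p \<in> B \<and> snd p \<in> S \<and> fst p < snd p \<and> snd p < fst p + \<delta> (fst p)) \<longrightarrow>
       pairwise (\<lambda>p q. disjnt {fst p<..<snd p} {fst q<..<snd q}) P \<longrightarrow> (\<Sum>p\<in>P. \<bar>F (snd p) - F (fst p)\<bar>) \<le> e"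
    using assms(1) unfolding null_right_variation_def by meson
  show "\<exists>\<delta>. (\<forall>x. 0 < \<delta> x) \<and>
    (\<forall>P. finite P \<longrightarrow> (\<forall>p\<in>P. fst p \<in> A \<and> snd p \<in> S \<and> fst p < snd p \<and> snd p < fst p + \<delta> (fst p)) \<longrightarrow>
       pairwise (\<lambda>p q. disjnt {fst p<..<snd p} {fst q<..<snd q}) P \<longrightarrow> (\<Sum>p\<in>P. \<bar>F (snd p) - F (fst p)\<bar>) \<le> e)"
    using \<delta> \<open>A \<subseteq> B\<close> by (intro exI[of _ \<delta>]) blast
qed

lemma disjoint_intervals_eq_if_fst_eq:
  fixes P :: "(real \<times> real) set"
  assumes "pairwise (\<lambda>p q. disjnt {fst p<..<snd p} {fst q<..<snd q}) P"
    "p \<in> P" "q \<in> P" "fst p = fst q" "fst p < snd p" "fst q < snd q"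
  shows "p = q"
proof (rule ccontr)
  assume "p \<noteq> q"
  then have "disjnt {fst p<..<snd p} {fst q<..<snd q}" using assms(1-3) by (auto simp: pairwise_def)
  moreover obtain y where "fst p < y" "y < min (snd p) (snd q)"
    using dense[of "fst p" "min (snd p) (snd q)"] assms(4-6) by auto
  ultimately show False using assms(4) by (auto simp: disjnt_iff)
qed

section \<open>Variation over countable sets and null sets\<close>

text \<open>Non-overlapping intervals cannot share a left endpoint, so at most one interval has the
  tag \<open>x\<close>, and continuity makes its increment small.\<close>

lemma null_right_variation_singleton:
  assumes "continuous_on S F" "x \<in> S"
  shows "null_right_variation S F {x}"
  unfolding null_right_variation_def
proof (intro allI impI)
  fix e :: real assume "0 < e"
  then obtain d where d: "d > 0" "\<And>y. y \<in> S \<Longrightarrow> dist y x < d \<Longrightarrow> dist (F y) (F x) < e"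
    using assms unfolding continuous_on_iff by metis
  show "\<exists>\<delta>. (\<forall>z. 0 < \<delta> z) \<and>
    (\<forall>P. finite P \<longrightarrow> (\<forall>p\<in>P. fst p \<in> {x} \<and> snd p \<in> S \<and> fst p < snd p \<and> snd p < fst p + \<delta> (fst p)) \<longrightarrow>
       pairwise (\<lambda>p q. disjnt {fst p<..<snd p} {fst q<..<snd q}) P \<longrightarrow> (\<Sum>p\<in>P. \<bar>F (snd p) - F (fst p)\<bar>) \<le> e)"
  proof (intro exI[of _ "\<lambda>_. d"] conjI allI impI)
    fix P assume P: "finite P" "\<forall>p\<in>P. fst p \<in> {x} \<and> snd p \<in> S \<and> fst p < snd p \<and> snd p < fst p + d"
       "pairwise (\<lambda>p q. disjnt {fst p<..<snd p} {fst q<..<snd q}) P"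
    show "(\<Sum>p\<in>P. \<bar>F (snd p) - F (fst p)\<bar>) \<le> e"
    proof (cases "P = {}")
      case False
      then obtain p where p: "p \<in> P" by blast
      have "P = {p}" using disjoint_intervals_eq_if_fst_eq[OF P(3) p] p P(2) by auto
      moreover have "dist (F (snd p)) (F x) < e" using P(2) p by (intro d) (auto simp: dist_real_def)
      ultimately show ?thesis using P(2) p by (auto simp: dist_real_def)
    qed (use \<open>0 < e\<close> in auto)
  qed (use d in auto)
qed

text \<open>The sets may overlap: a tag is charged to the first \<open>A i\<close> containing it,
  and this set is allowed the share \<open>e * (1/2)^Suc i\<close> of the error.\<close>

lemma null_right_variation_UN:
  fixes A :: "nat \<Rightarrow> real set"
  assumes "\<And>i. null_right_variation S F (A i)"
  shows "null_right_variation S F (\<Union>i. A i)"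
  unfolding null_right_variation_def
proof (intro allI impI)
  fix e :: real assume "0 < e"
  define c where "c = (\<lambda>i. e * (1/2)^Suc i)"
  have "\<forall>i. \<exists>\<delta>. (\<forall>x. 0 < \<delta> x) \<and>
    (\<forall>P. finite P \<longrightarrow> (\<forall>p\<in>P. fst p \<in> A i \<and> snd p \<in> S \<and> fst p < snd p \<and> snd p < fst p + \<delta> (fst p)) \<longrightarrow>
       pairwise (\<lambda>p q. disjnt {fst p<..<snd p} {fst q<..<snd q}) P \<longrightarrow> (\<Sum>p\<in>P. \<bar>F (snd p) - F (fst p)\<bar>) \<le> c i)"
  proof
    fix i
    have "c i > 0" using \<open>0 < e\<close> by (simp add: c_def)
    with assms[of i] show "\<exists>\<delta>. (\<forall>x. 0 < \<delta> x) \<and>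
    (\<forall>P. finite P \<longrightarrow> (\<forall>p\<in>P. fst p \<in> A i \<and> snd p \<in> S \<and> fst p < snd p \<and> snd p < fst p + \<delta> (fst p)) \<longrightarrow>
       pairwise (\<lambda>p q. disjnt {fst p<..<snd p} {fst q<..<snd q}) P \<longrightarrow> (\<Sum>p\<in>P. \<bar>F (snd p) - F (fst p)\<bar>) \<le> c i)"
      unfolding null_right_variation_def by blast
  qed
  then obtain \<delta> where \<delta>: "\<forall>i. (\<forall>x. 0 < \<delta> i x) \<and>
    (\<forall>P. finite P \<longrightarrow> (\<forall>p\<in>P. fst p \<in> A i \<and> snd p \<in> S \<and> fst p < snd p \<and> snd p < fst p + \<delta> i (fst p)) \<longrightarrow>
       pairwise (\<lambda>p q. disjnt {fst p<..<snd p} {fst q<..<snd q}) P \<longrightarrow> (\<Sum>p\<in>P. \<bar>F (snd p) - F (fst p)\<bar>) \<le> c i)"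
    by (rule choice[THEN exE])
  define \<iota> where "\<iota> = (\<lambda>x. LEAST i. x \<in> A i)"
  have \<iota>: "x \<in> A (\<iota> x)" if "x \<in> (\<Union>i. A i)" for x
    unfolding \<iota>_def using that by (auto intro: LeastI)
  show "\<exists>\<delta>. (\<forall>x. 0 < \<delta> x) \<and>
    (\<forall>P. finite P \<longrightarrow> (\<forall>p\<in>P. fst p \<in> (\<Union>i. A i) \<and> snd p \<in> S \<and> fst p < snd p \<and> snd p < fst p + \<delta> (fst p)) \<longrightarrow>
       pairwise (\<lambda>p q. disjnt {fst p<..<snd p} {fst q<..<snd q}) P \<longrightarrow> (\<Sum>p\<in>P. \<bar>F (snd p) - F (fst p)\<bar>) \<le> e)"
  proof (intro exI[of _ "\<lambda>x. \<delta> (\<iota> x) x"] conjI allI impI)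
    fix P assume P: "finite P"
      "\<forall>p\<in>P. fst p \<in> (\<Union>i. A i) \<and> snd p \<in> S \<and> fst p < snd p \<and> snd p < fst p + \<delta> (\<iota> (fst p)) (fst p)"
      "pairwise (\<lambda>p q. disjnt {fst p<..<snd p} {fst q<..<snd q}) P"
    define I where "I = (\<lambda>p. \<iota> (fst p)) ` P"
    have "(\<Sum>p\<in>P. \<bar>F (snd p) - F (fst p)\<bar>) = (\<Sum>i\<in>I. \<Sum>p\<in>{p\<in>P. \<iota> (fst p) = i}. \<bar>F (snd p) - F (fst p)\<bar>)"
      unfolding I_def using P(1) by (rule sum.image_gen)
    also have "\<dots> \<le> (\<Sum>i\<in>I. c i)"
    proof (rule sum_mono)
      fix i assume "i \<in> I"
      show "(\<Sum>p\<in>{p\<in>P. \<iota> (fst p) = i}. \<bar>F (snd p) - F (fst p)\<bar>) \<le> c i"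
        using P \<iota> by (intro \<delta>[rule_format, THEN conjunct2, rule_format])
          (auto intro: pairwise_subset)
    qed
    also have "\<dots> \<le> suminf c"
    proof (rule sum_le_suminf)
      show "summable c" unfolding c_def using power_half_series by (intro summable_mult) (rule sums_summable)
    qed (use P \<open>0 < e\<close> in \<open>auto simp: I_def c_def\<close>)
    also have "suminf c = e"
      unfolding c_def using sums_mult[OF power_half_series, of e] by (simp add: sums_iff)
    finally show "(\<Sum>p\<in>P. \<bar>F (snd p) - F (fst p)\<bar>) \<le> e" .
  qed (use \<delta> in auto)
qed

lemma null_right_variation_countable:
  assumes "continuous_on S F" "countable A" "A \<subseteq> S"
  shows "null_right_variation S F A"
proof (cases "A = {}")
  case True
  show ?thesis unfolding null_right_variation_def
  proof (intro allI impI exI[of _ "\<lambda>_. 1"] conjI)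
    fix e :: real and P :: "(real \<times> real) set"
    assume "0 < e" "\<forall>p\<in>P. fst p \<in> A \<and> snd p \<in> S \<and> fst p < snd p \<and> snd p < fst p + 1"
    moreover from this True have "P = {}" by blast
    ultimately show "(\<Sum>p\<in>P. \<bar>F (snd p) - F (fst p)\<bar>) \<le> e" by simp
  qed simp
next
  case False
  have "null_right_variation S F (\<Union>i. {from_nat_into A i})"
    using assms from_nat_into[OF False] by (intro null_right_variation_UN null_right_variation_singleton) auto
  then show ?thesis
    by (rule null_right_variation_subset) (use from_nat_into_surj[OF assms(2)] in fastforce)
qed

lemma negligible_open_cover:
  fixes A :: "real set"
  assumes "negligible A" "0 < e"
  obtains U where "open U" "A \<subseteq> U" "U \<in> lmeasurable" "measure lebesgue U < e"
proof -
  have "A \<in> sets lebesgue" using assms(1) by (simp add: negligible_imp_sets)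
  then obtain U where U: "open U" "A \<subseteq> U" "U - A \<in> lmeasurable" "emeasure lebesgue (U - A) < ennreal e"
    using sets_lebesgue_outer_open[OF _ assms(2)] by blast
  have null: "A \<in> null_sets lebesgue" using assms(1) by (simp add: negligible_iff_null_sets)
  have Us: "U \<in> sets lebesgue" using U(1) by auto
  have em: "emeasure lebesgue U = emeasure lebesgue (U - A)"
    using emeasure_Diff_null_set[OF null Us] by simp
  have "U \<in> lmeasurable" using U(4) Us unfolding em[symmetric]
    by (intro fmeasurableI) (auto intro: order.strict_trans)
  moreover have "measure lebesgue U < e"
    using U(4) \<open>U \<in> lmeasurable\<close> unfolding em[symmetric]
    by (simp add: emeasure_eq_measure2 ennreal_less_iff)
  ultimately show ?thesis using that U by blast
qed

text \<open>Each tag \<open>x\<close> gets a point \<open>e x\<close> of \<open>E\<close> to its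
  right with \<open>{x..e x}\<close> inside an open set \<open>U\<close> of measure below
  \<open>\<eta>\<close>. The gauge \<open>e x - x\<close> keeps intervals with left endpoint
  \<open>x\<close> short of \<open>e x\<close>, so they can be enlarged to intervals with endpoints
  in \<open>E\<close> without leaving \<open>U\<close>.\<close>

lemma AC_star_on_null_right_variation_limit:
  assumes "AC_star_on E F" "negligible Z"
  shows "null_right_variation S F {x\<in>E \<inter> Z. \<forall>r>0. E \<inter> {x<..<x + r} \<noteq> {}}" (is "null_right_variation S F ?A")
  unfolding null_right_variation_def
proof (intro allI impI)
  fix \<epsilon> :: real assume "0 < \<epsilon>"
  obtain \<eta> where \<eta>: "0 < \<eta>" and AC: "\<forall>Q \<sigma> \<tau>. finite Q \<longrightarrow>
       (\<forall>p\<in>Q. fst p \<in> E \<and> snd p \<in> E \<and> fst p \<le> snd p) \<longrightarrow>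
       pairwise (\<lambda>p q. disjnt {fst p<..<snd p} {fst q<..<snd q}) Q \<longrightarrow> (\<Sum>p\<in>Q. snd p - fst p) < \<eta> \<longrightarrow>
       (\<forall>p\<in>Q. \<sigma> p \<in> {fst p..snd p} \<and> \<tau> p \<in> {fst p..snd p}) \<longrightarrow>
       (\<Sum>p\<in>Q. \<bar>F (\<sigma> p) - F (\<tau> p)\<bar>) < \<epsilon>"
    by (rule AC_star_onE[OF assms(1) \<open>0 < \<epsilon>\<close>])
  have "negligible (E \<inter> Z)" using assms(2) negligible_subset by blast
  then obtain U where U: "open U" "E \<inter> Z \<subseteq> U" "U \<in> lmeasurable" "measure lebesgue U < \<eta>"
    using negligible_open_cover \<eta> by blast
  have ex: "\<exists>y. x \<in> ?A \<longrightarrow> y \<in> E \<and> x < y \<and> {x..y} \<subseteq> U" for x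
  proof (cases "x \<in> ?A")
    case True
    then obtain r where r: "r > 0" "ball x r \<subseteq> U" using U open_contains_ball by blast
    then obtain y where "y \<in> E \<inter> {x<..<x + r}" using True by blast
    moreover from this have "{x..y} \<subseteq> ball x r" by (auto simp: dist_real_def)
    ultimately show ?thesis using r by auto
  qed auto
  then have "\<exists>e. \<forall>x. x \<in> ?A \<longrightarrow> e x \<in> E \<and> x < e x \<and> {x..e x} \<subseteq> U"
    by (intro choice allI)
  then obtain e where e: "\<forall>x. x \<in> ?A \<longrightarrow> e x \<in> E \<and> x < e x \<and> {x..e x} \<subseteq> U" ..
  define \<delta> where "\<delta> = (\<lambda>x. if x \<in> ?A then e x - x else 1)"
  show "\<exists>\<delta>. (\<forall>x. 0 < \<delta> x) \<and>
    (\<forall>P. finite P \<longrightarrow> (\<forall>p\<in>P. fst p \<in> ?A \<and> snd p \<in> S \<and> fst p < snd p \<and> snd p < fst p + \<delta> (fst p)) \<longrightarrow>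
       pairwise (\<lambda>p q. disjnt {fst p<..<snd p} {fst q<..<snd q}) P \<longrightarrow> (\<Sum>p\<in>P. \<bar>F (snd p) - F (fst p)\<bar>) \<le> \<epsilon>)"
  proof (intro exI[of _ \<delta>] conjI allI impI)
    show "0 < \<delta> x" for x using e by (simp add: \<delta>_def)
  next
    fix P assume P: "finite P"
      "\<forall>p\<in>P. fst p \<in> ?A \<and> snd p \<in> S \<and> fst p < snd p \<and> snd p < fst p + \<delta> (fst p)"
      "pairwise (\<lambda>p q. disjnt {fst p<..<snd p} {fst q<..<snd q}) P"
    \<comment> \<open>A tag determines its interval, so the intervals can be indexed by the tags;
      this makes it possible to speak of the next tag.\<close>
    define T where "T = fst ` P"
    have "finite T" using P(1) by (simp add: T_def)
    have "\<forall>t\<in>T. \<exists>v. (t, v) \<in> P" by (auto simp: T_def)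
    then obtain v where v: "\<And>t. t \<in> T \<Longrightarrow> (t, v t) \<in> P" by metis
    have P_eq: "P = (\<lambda>t. (t, v t)) ` T"
    proof (intro equalityI subsetI)
      fix p assume "p \<in> P"
      then have t: "fst p \<in> T" by (auto simp: T_def)
      have "p = (fst p, v (fst p))"
        using v[OF t] \<open>p \<in> P\<close> P(2) by (intro disjoint_intervals_eq_if_fst_eq[OF P(3)]) auto
      then show "p \<in> (\<lambda>t. (t, v t)) ` T" using t by blast
    qed (use v in auto)
    have T: "t \<in> ?A" "t < v t" "v t < e t" if "t \<in> T" for t
      using P(2)[rule_format, OF v[OF that]] by (auto simp: \<delta>_def)
    have v_le: "v t \<le> t'" if "t \<in> T" "t' \<in> T" "t < t'" for t t'
    proof (rule ccontr)
      assume "\<not> v t \<le> t'"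
      then obtain y where "t' < y" "y < min (v t) (v t')"
        using dense[of t' "min (v t) (v t')"] T(2)[OF \<open>t' \<in> T\<close>] \<open>\<not> v t \<le> t'\<close> by auto
      moreover have "disjnt {t<..<v t} {t'<..<v t'}"
        using pairwiseD[OF P(3) v[OF that(1)] v[OF that(2)]] that(3) by auto
      ultimately show False using that(3) by (auto simp: disjnt_iff)
    qed
    \<comment> \<open>The right endpoints \<open>v t\<close> need not lie in \<open>E\<close>; \<open>w t\<close> is in \<open>E\<close>, beyond \<open>v t\<close> but not beyond the next tag.\<close>
    define w where "w = (\<lambda>t. Min (insert (e t) {t'\<in>T. t < t'}))"
    have w_in: "w t \<in> insert (e t) {t'\<in>T. t < t'}" for t
      unfolding w_def using \<open>finite T\<close> by (intro Min_in) auto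
    have w_le: "w t \<le> e t" "\<And>t'. t' \<in> T \<Longrightarrow> t < t' \<Longrightarrow> w t \<le> t'" for t
      unfolding w_def using \<open>finite T\<close> by (auto intro: Min_le)
    \<comment> \<open>\<open>w t\<close> is \<open>e t\<close> or a later tag, hence in
      \<open>E\<close>. The gauge keeps \<open>v t\<close> below \<open>e t\<close>, and
      disjointness keeps it from passing a later tag.\<close>
    have w: "w t \<in> E" "v t \<le> w t" if "t \<in> T" for t
      using w_in[of t] e T[OF that] T(1) v_le[OF that] by auto
    have tw: "t < w t" if "t \<in> T" for t using T(2) w(2) that by fastforce
    define Q where "Q = (\<lambda>t. (t, w t)) ` T"
    have "(\<Sum>p\<in>P. \<bar>F (snd p) - F (fst p)\<bar>) = (\<Sum>t\<in>T. \<bar>F (v t) - F t\<bar>)"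
      unfolding P_eq by (subst sum.reindex) (auto simp: inj_on_def)
    also have "\<dots> = (\<Sum>q\<in>Q. \<bar>F (v (fst q)) - F (fst q)\<bar>)"
      unfolding Q_def by (subst sum.reindex) (auto simp: inj_on_def)
    also have "\<dots> < \<epsilon>"
    proof (intro AC[rule_format])
      show "finite Q" using \<open>finite T\<close> by (simp add: Q_def)
      show fE: "fst q \<in> E \<and> snd q \<in> E \<and> fst q \<le> snd q" if "q \<in> Q" for q
        using that w T tw by (auto simp: Q_def intro: less_imp_le)
      show Qd: "pairwise (\<lambda>p q. disjnt {fst p<..<snd p} {fst q<..<snd q}) Q"
      proof (rule pairwiseI)
        fix p q assume "p \<in> Q" "q \<in> Q" "p \<noteq> q"
        then obtain s t where *: "s \<in> T" "t \<in> T" "s \<noteq> t" "p = (s, w s)" "q = (t, w t)"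
          by (auto simp: Q_def)
        then have "w s \<le> t \<or> w t \<le> s" using w_le by (metis linorder_neqE)
        then show "disjnt {fst p<..<snd p} {fst q<..<snd q}" using * by (auto simp: disjnt_iff)
      qed
      have "(\<Sum>q\<in>Q. snd q - fst q) \<le> measure lebesgue U"
      proof (intro sum_lengths_le_measure \<open>finite Q\<close> Qd U)
        fix q assume "q \<in> Q"
        then obtain t where t: "t \<in> T" "q = (t, w t)" by (auto simp: Q_def)
        have "{t<..<w t} \<subseteq> {t..e t}" using w_le(1)[of t] by auto
        also have "\<dots> \<subseteq> U" using e T(1)[OF t(1)] by blast
        finally show "fst q \<le> snd q \<and> {fst q<..<snd q} \<subseteq> U" using t tw by (auto intro: less_imp_le)
      qed
      then show "(\<Sum>q\<in>Q. snd q - fst q) < \<eta>" using U(4) by linarith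
      show "v (fst q) \<in> {fst q..snd q} \<and> fst q \<in> {fst q..snd q}" if "q \<in> Q" for q
        using that T(2) w(2) tw by (auto simp: Q_def intro: less_imp_le)
    qed
    finally show "(\<Sum>p\<in>P. \<bar>F (snd p) - F (fst p)\<bar>) \<le> \<epsilon>" by simp
  qed
qed

lemma AC_star_on_null_right_variation:
  assumes "AC_star_on E F" "negligible Z" "continuous_on S F" "E \<subseteq> S"
  shows "null_right_variation S F (E \<inter> Z)"
proof -
  \<comment> \<open>Only two sets are needed; the second is repeated to obtain a sequence.\<close>
  define A where "A = (\<lambda>i::nat. if i = 0 then {x\<in>E \<inter> Z. \<forall>r>0. E \<inter> {x<..<x + r} \<noteq> {}}
      else {x\<in>E. \<exists>r>0. E \<inter> {x<..<x + r} = {}})"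
  have "null_right_variation S F (\<Union>i. A i)"
  proof (rule null_right_variation_UN)
    fix i
    show "null_right_variation S F (A i)"
    proof (cases "i = 0")
      case True
      show ?thesis unfolding A_def if_P[OF True]
        by (rule AC_star_on_null_right_variation_limit[OF assms(1,2)])
    next
      case False
      have "null_right_variation S F {x\<in>E. \<exists>r>0. E \<inter> {x<..<x + r} = {}}"
        using assms(3,4) by (intro null_right_variation_countable countable_right_isolated) auto
      then show ?thesis unfolding A_def by (simp only: if_not_P[OF False])
    qed
  qed
  then show ?thesis
  proof (rule null_right_variation_subset, intro subsetI)
    fix x assume "x \<in> E \<inter> Z"
    then have "x \<in> A 0 \<or> x \<in> A 1" by (auto simp: A_def)
    then show "x \<in> (\<Union>i. A i)" by blast
  qed
qed

lemma ACG_star_null_right_variation: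
  assumes "ACG_star a b F" "negligible Z"
  shows "null_right_variation {a..b} F ({a..b} \<inter> Z)"
proof -
  obtain E :: "nat \<Rightarrow> real set" where E: "(\<Union>i. E i) = {a..b}" "\<And>i. AC_star_on (E i) F"
    using assms by (auto simp: ACG_star_def)
  have "null_right_variation {a..b} F (\<Union>i. E i \<inter> Z)"
    using assms E by (intro null_right_variation_UN AC_star_on_null_right_variation) (auto simp: ACG_star_def)
  then show ?thesis using E(1) by (simp add: Int_UN_distrib2[symmetric] UN_extend_simps)
qed

section \<open>Reflection of the line\<close>

lemma AC_star_on_reflect:
  assumes "AC_star_on E F"
  shows "AC_star_on (uminus ` E) (\<lambda>x. F (- x))"
  unfolding AC_star_on_def
proof (intro allI impI)
  fix e :: real assume "e > 0"
  then obtain \<eta> where \<eta>: "0 < \<eta>" "\<forall>(N::nat) c d.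
      (\<forall>i<N. c i \<in> E \<and> d i \<in> E \<and> c i \<le> d i) \<and> disjoint_family_on (\<lambda>i. {c i<..<d i}) {..<N} \<and>
      (\<Sum>i<N. d i - c i) < \<eta> \<longrightarrow>
      (\<Sum>i<N. SUP s\<in>{c i..d i}. SUP t\<in>{c i..d i}. ennreal \<bar>F s - F t\<bar>) < ennreal e"
    using assms unfolding AC_star_on_def by meson
  have SUP_reflect: "(SUP s\<in>{c..d}. G (- s)) = (SUP s\<in>{- d..- c}. G s)" for c d :: real and G :: "real \<Rightarrow> ennreal"
  proof -
    have "(SUP s\<in>{- d..- c}. G s) = (SUP s\<in>uminus ` {c..d}. G s)" by simp
    also have "\<dots> = (SUP s\<in>{c..d}. G (- s))" by (simp only: image_image)
    finally show ?thesis by simp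
  qed
  show "\<exists>\<eta>>0. \<forall>(N::nat) c d.
      (\<forall>i<N. c i \<in> uminus ` E \<and> d i \<in> uminus ` E \<and> c i \<le> d i) \<and> disjoint_family_on (\<lambda>i. {c i<..<d i}) {..<N} \<and>
      (\<Sum>i<N. d i - c i) < \<eta> \<longrightarrow>
      (\<Sum>i<N. SUP s\<in>{c i..d i}. SUP t\<in>{c i..d i}. ennreal \<bar>F (- s) - F (- t)\<bar>) < ennreal e"
  proof (intro exI[of _ \<eta>] conjI \<eta>(1) allI impI, elim conjE)
    fix N :: nat and c d :: "nat \<Rightarrow> real"
    assume *: "\<forall>i<N. c i \<in> uminus ` E \<and> d i \<in> uminus ` E \<and> c i \<le> d i"
      "disjoint_family_on (\<lambda>i. {c i<..<d i}) {..<N}" "(\<Sum>i<N. d i - c i) < \<eta>"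
    have "(SUP s\<in>{c i..d i}. SUP t\<in>{c i..d i}. ennreal \<bar>F (- s) - F (- t)\<bar>)
        = (SUP s\<in>{- d i..- c i}. SUP t\<in>{- d i..- c i}. ennreal \<bar>F s - F t\<bar>)" for i
      using SUP_reflect[of "\<lambda>s. SUP t\<in>{c i..d i}. ennreal \<bar>F s - F (- t)\<bar>"]
        SUP_reflect[of "\<lambda>t. ennreal \<bar>F s - F t\<bar>" for s] by simp
    moreover have "disjoint_family_on (\<lambda>i. {- d i<..<- c i}) {..<N}"
      unfolding disjoint_family_on_def
    proof (intro ballI impI)
      fix i j assume "i \<in> {..<N}" "j \<in> {..<N}" "i \<noteq> j"
      then have "{c i<..<d i} \<inter> {c j<..<d j} = {}" using *(2) by (auto simp: disjoint_family_on_def)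
      then have "uminus ` ({c i<..<d i} \<inter> {c j<..<d j}) = {}" by simp
      then show "{- d i<..<- c i} \<inter> {- d j<..<- c j} = {}" by (simp add: image_Int)
    qed
    moreover have "\<forall>i<N. - d i \<in> E \<and> - c i \<in> E \<and> - d i \<le> - c i" using *(1) by force
    moreover have "(\<Sum>i<N. - c i - - d i) < \<eta>" using *(3) by simp
    ultimately show "(\<Sum>i<N. SUP s\<in>{c i..d i}. SUP t\<in>{c i..d i}. ennreal \<bar>F (- s) - F (- t)\<bar>) < ennreal e"
      using \<eta>(2)[rule_format, of N "\<lambda>i. - d i" "\<lambda>i. - c i"] by simp
  qed
qed

lemma ACG_star_reflect:
  assumes "ACG_star a b F"
  shows "ACG_star (- b) (- a) (\<lambda>x. F (- x))"
proof -
  obtain E :: "nat \<Rightarrow> real set" where E: "(\<Union>i. E i) = {a..b}" "\<And>i. AC_star_on (E i) F"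
    and cont: "continuous_on {a..b} F"
    using assms by (auto simp: ACG_star_def)
  have "continuous_on {- b..- a} (\<lambda>x. F (- x))"
    by (rule continuous_on_compose2[OF cont]) (auto intro!: continuous_intros)
  moreover have "(\<Union>i. uminus ` E i) = {- b..- a}" using E(1) by (simp add: image_UN[symmetric])
  moreover have "AC_star_on (uminus ` E i) (\<lambda>x. F (- x))" for i by (intro AC_star_on_reflect E)
  ultimately show ?thesis unfolding ACG_star_def by (intro conjI exI[of _ "\<lambda>i. uminus ` E i"]) auto
qed

section \<open>Integration of the derivative\<close>

text \<open>This is the form in which halves of a tagged division arise: a tag at an endpoint leaves
  a degenerate half, and several degenerate halves may coincide. They contribute nothing, and
  non-overlapping makes the remaining pairs distinct.\<close>

lemma null_right_variationE:
  assumes "null_right_variation S F A" "0 < e"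
  obtains \<delta> where "\<And>x. 0 < \<delta> x"
    "\<And>(D :: 'i set) x v. finite D \<Longrightarrow>
       (\<And>d. d \<in> D \<Longrightarrow> x d \<in> A \<and> v d \<in> S \<and> x d \<le> v d \<and> v d < x d + \<delta> (x d)) \<Longrightarrow>
       pairwise (\<lambda>d e. disjnt {x d<..<v d} {x e<..<v e}) D \<Longrightarrow> (\<Sum>d\<in>D. \<bar>F (v d) - F (x d)\<bar>) \<le> e"
proof -
  obtain \<delta> where \<delta>: "\<forall>x. 0 < \<delta> x"
    "\<forall>P. finite P \<longrightarrow> (\<forall>p\<in>P. fst p \<in> A \<and> snd p \<in> S \<and> fst p < snd p \<and> snd p < fst p + \<delta> (fst p)) \<longrightarrow>
       pairwise (\<lambda>p q. disjnt {fst p<..<snd p} {fst q<..<snd q}) P \<longrightarrow> (\<Sum>p\<in>P. \<bar>F (snd p) - F (fst p)\<bar>) \<le> e"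
    using assms unfolding null_right_variation_def by meson
  show ?thesis
  proof (rule that[of \<delta>])
    fix D :: "'i set" and x v
    assume D: "finite D" "\<And>d. d \<in> D \<Longrightarrow> x d \<in> A \<and> v d \<in> S \<and> x d \<le> v d \<and> v d < x d + \<delta> (x d)"
       "pairwise (\<lambda>d e. disjnt {x d<..<v d} {x e<..<v e}) D"
    define D' where "D' = {d\<in>D. x d < v d}"
    have inj: "inj_on (\<lambda>d. (x d, v d)) D'"
    proof (rule inj_onI, rule ccontr)
      fix d e assume *: "d \<in> D'" "e \<in> D'" "(x d, v d) = (x e, v e)" "d \<noteq> e"
      then have "disjnt {x d<..<v d} {x e<..<v e}"
        by (intro pairwiseD[OF D(3)]) (auto simp: D'_def)
      moreover have "x e < v e" using * by (simp add: D'_def)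
      ultimately show False using *(3) by (simp add: disjnt_def)
    qed
    have "(\<Sum>d\<in>D. \<bar>F (v d) - F (x d)\<bar>) = (\<Sum>d\<in>D'. \<bar>F (v d) - F (x d)\<bar>)"
      unfolding D'_def using D by (intro sum.mono_neutral_right) (force simp: less_le)+
    also have "\<dots> = (\<Sum>p\<in>(\<lambda>d. (x d, v d)) ` D'. \<bar>F (snd p) - F (fst p)\<bar>)"
      using inj by (subst sum.reindex) auto
    also have "\<dots> \<le> e"
    proof (intro \<delta>(2)[rule_format])
      show "pairwise (\<lambda>p q. disjnt {fst p<..<snd p} {fst q<..<snd q}) ((\<lambda>d. (x d, v d)) ` D')"
        using D(3) by (auto simp: pairwise_def D'_def)
    qed (use D in \<open>auto simp: D'_def\<close>)
    finally show "(\<Sum>d\<in>D. \<bar>F (v d) - F (x d)\<bar>) \<le> e" .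
  qed (use \<delta> in auto)
qed

text \<open>Setting the integrand to 0 on \<open>Z\<close> reduces the error at a tag in
  \<open>Z\<close> to the increment of \<open>F\<close>, which is split at the tag into two halves
  of negligible total variation. At other tags the derivative gives an error proportional to the
  length.\<close>

theorem ACG_star_has_integral:
  assumes F: "ACG_star a b F" and "a \<le> b" and Z: "negligible Z"
    and deriv: "\<And>x. x \<in> {a..b} - Z \<Longrightarrow> (F has_real_derivative g x) (at x within {a..b})"
  shows "(g has_integral (F b - F a)) {a..b}"
proof -
  define g' where "g' = (\<lambda>x. if x \<in> Z then 0 else g x)"
  have "(g' has_integral (F b - F a)) {a..b}"
    unfolding has_integral_real
  proof (intro allI impI)
    fix e :: real assume "e > 0"
    \<comment> \<open>The tags outside \<open>Z\<close>, the right halves and the left halves get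
      \<open>e / 4\<close> each, which leaves a strict inequality; \<open>b - a + 1\<close> avoids
      division by zero when \<open>a = b\<close>.\<close>
    define e1 where "e1 = e / (4 * (b - a + 1))"
    have e1: "e1 > 0" "e1 * (b - a) \<le> e / 4"
      using \<open>e > 0\<close> \<open>a \<le> b\<close> by (auto simp: e1_def field_simps)
    have e4: "e / 4 > 0" using \<open>e > 0\<close> by simp
    obtain \<delta>r where \<delta>r: "\<And>x. 0 < \<delta>r x"
      "\<And>(D :: (real \<times> real set) set) x v. finite D \<Longrightarrow>
       (\<And>d. d \<in> D \<Longrightarrow> x d \<in> {a..b} \<inter> Z \<and> v d \<in> {a..b} \<and> x d \<le> v d \<and> v d < x d + \<delta>r (x d)) \<Longrightarrow>
       pairwise (\<lambda>d e. disjnt {x d<..<v d} {x e<..<v e}) D \<Longrightarrow> (\<Sum>d\<in>D. \<bar>F (v d) - F (x d)\<bar>) \<le> e / 4"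
      using null_right_variationE[OF ACG_star_null_right_variation[OF F Z] e4] by blast
    have "negligible (uminus ` Z)" 
      by (intro negligible_differentiable_image_negligible Z linear_imp_differentiable_on linear_uminus) auto
    from ACG_star_null_right_variation[OF ACG_star_reflect[OF F] this]
    obtain \<delta>l where \<delta>l: "\<And>x. 0 < \<delta>l x"
      "\<And>(D :: (real \<times> real set) set) x v. finite D \<Longrightarrow>
       (\<And>d. d \<in> D \<Longrightarrow> x d \<in> {- b..- a} \<inter> uminus ` Z \<and> v d \<in> {- b..- a} \<and> x d \<le> v d \<and> v d < x d + \<delta>l (x d)) \<Longrightarrow>
       pairwise (\<lambda>d e. disjnt {x d<..<v d} {x e<..<v e}) D \<Longrightarrow> (\<Sum>d\<in>D. \<bar>F (- v d) - F (- x d)\<bar>) \<le> e / 4"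
      using null_right_variationE[OF _ e4] by blast
    have "\<exists>d>0. x \<in> {a..b} - Z \<longrightarrow> (\<forall>y\<in>{a..b}. \<bar>y - x\<bar> < d \<longrightarrow> \<bar>F y - F x - g x * (y - x)\<bar> \<le> e1 * \<bar>y - x\<bar>)" for x
    proof (cases "x \<in> {a..b} - Z")
      case True
      then have "(F has_derivative (\<lambda>h. g x * h)) (at x within {a..b})"
        using deriv by (auto simp: has_field_derivative_def mult_commute_abs)
      then show ?thesis using e1(1) unfolding has_derivative_within_alt by fastforce
    qed (auto intro: exI[of _ 1])
    then obtain \<delta>d where \<delta>d: "\<And>x. \<delta>d x > 0"
       "\<And>x y. x \<in> {a..b} - Z \<Longrightarrow> y \<in> {a..b} \<Longrightarrow> \<bar>y - x\<bar> < \<delta>d x \<Longrightarrow> \<bar>F y - F x - g x * (y - x)\<bar> \<le> e1 * \<bar>y - x\<bar>"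
      by metis
    \<comment> \<open>\<open>\<delta>l\<close> belongs to the reflected function and is therefore
      evaluated at \<open>- x\<close>.\<close>
    define \<gamma> where "\<gamma> = (\<lambda>x. ball x (min (\<delta>d x) (min (\<delta>r x) (\<delta>l (- x)))))"
    show "\<exists>\<gamma>. gauge \<gamma> \<and> (\<forall>D. D tagged_division_of {a..b} \<and> \<gamma> fine D \<longrightarrow>
             norm ((\<Sum>(x, k)\<in>D. measure lborel k *\<^sub>R g' x) - (F b - F a)) < e)"
    proof (intro exI[of _ \<gamma>] conjI allI impI)
      show "gauge \<gamma>"
        unfolding \<gamma>_def using \<delta>d(1) \<delta>r(1) \<delta>l(1) by (intro gauge_ball_dependent) auto
    next
      fix D assume "D tagged_division_of {a..b} \<and> \<gamma> fine D"
      then have D: "D tagged_division_of {a..b}" and fine: "\<gamma> fine D" by auto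
      note Dd = tagged_division_ofD[OF D]
      have K: "\<exists>u v. K = {u..v} \<and> Inf K = u \<and> Sup K = v \<and> u \<le> x \<and> x \<le> v \<and> a \<le> u \<and> v \<le> b \<and>
          measure lborel K = v - u \<and> interior K = {u<..<v} \<and>
          v - x < min (\<delta>d x) (min (\<delta>r x) (\<delta>l (- x))) \<and> x - u < min (\<delta>d x) (min (\<delta>r x) (\<delta>l (- x)))"
        if xK: "(x, K) \<in> D" for x K
      proof -
        obtain u v where uv: "K = {u..v}" using Dd(4)[OF xK] by auto
        have "x \<in> K" "K \<subseteq> {a..b}" using Dd(2,3)[OF xK] by auto
        then have ux: "u \<le> x" "x \<le> v" "a \<le> u" "v \<le> b" using uv by auto
        have "K \<subseteq> \<gamma> x" using fineD[OF fine xK] .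
        moreover have "u \<in> K" "v \<in> K" using ux uv by auto
        ultimately have "u \<in> \<gamma> x" "v \<in> \<gamma> x" by auto
        then show ?thesis using uv ux
          by (intro exI[of _ u] exI[of _ v]) (auto simp: \<gamma>_def dist_real_def)
      qed
      define R where "R = (\<lambda>(x, K). measure lborel K * g' x - (F (Sup K) - F (Inf K)))"
      define DZ where "DZ = {d\<in>D. fst d \<in> Z}"
      have "DZ \<subseteq> D" "finite DZ" using Dd(1) by (auto simp: DZ_def)
      have dis: "disjnt (interior (snd d)) (interior (snd d'))" if "d \<in> D" "d' \<in> D" "d \<noteq> d'" for d d'
        using Dd(5)[of "fst d" "snd d" "fst d'" "snd d'"] that by (auto simp: disjnt_def prod_eq_iff)
      have right: "(\<Sum>d\<in>DZ. \<bar>F (Sup (snd d)) - F (fst d)\<bar>) \<le> e / 4"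
      proof (rule \<delta>r(2)[OF \<open>finite DZ\<close>])
        show "fst d \<in> {a..b} \<inter> Z \<and> Sup (snd d) \<in> {a..b} \<and> fst d \<le> Sup (snd d) \<and> Sup (snd d) < fst d + \<delta>r (fst d)"
          if "d \<in> DZ" for d
          using K[of "fst d" "snd d"] that by (auto simp: DZ_def)
        show "pairwise (\<lambda>d d'. disjnt {fst d<..<Sup (snd d)} {fst d'<..<Sup (snd d')}) DZ"
        proof (rule pairwiseI)
          fix d d' assume dd: "d \<in> DZ" "d' \<in> DZ" "d \<noteq> d'"
          have "{fst d<..<Sup (snd d)} \<subseteq> interior (snd d)" if "d \<in> DZ" for d
            using K[of "fst d" "snd d"] that by (auto simp: DZ_def)
          with dis[of d d'] dd show "disjnt {fst d<..<Sup (snd d)} {fst d'<..<Sup (snd d')}"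
            by (meson \<open>DZ \<subseteq> D\<close> disjnt_subset1 disjnt_subset2 subsetD)
        qed
      qed
      have left: "(\<Sum>d\<in>DZ. \<bar>F (- (- Inf (snd d))) - F (- (- fst d))\<bar>) \<le> e / 4"
      proof (rule \<delta>l(2)[OF \<open>finite DZ\<close>])
        show "- fst d \<in> {- b..- a} \<inter> uminus ` Z \<and> - Inf (snd d) \<in> {- b..- a} \<and> - fst d \<le> - Inf (snd d) \<and>
            - Inf (snd d) < - fst d + \<delta>l (- fst d)" if "d \<in> DZ" for d
          using K[of "fst d" "snd d"] that by (auto simp: DZ_def)
        show "pairwise (\<lambda>d d'. disjnt {- fst d<..<- Inf (snd d)} {- fst d'<..<- Inf (snd d')}) DZ"
        proof (rule pairwiseI)
          fix d d' assume dd: "d \<in> DZ" "d' \<in> DZ" "d \<noteq> d'"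
          have sub: "{- fst d<..<- Inf (snd d)} \<subseteq> uminus ` interior (snd d)" if "d \<in> DZ" for d
            using K[of "fst d" "snd d"] that by (auto simp: DZ_def)
          have "disjnt (uminus ` interior (snd d)) (uminus ` interior (snd d'))"
            using dis[OF subsetD[OF \<open>DZ \<subseteq> D\<close> dd(1)] subsetD[OF \<open>DZ \<subseteq> D\<close> dd(2)] dd(3)]
            by (auto simp: disjnt_iff)
          with sub[OF dd(1)] sub[OF dd(2)] show "disjnt {- fst d<..<- Inf (snd d)} {- fst d'<..<- Inf (snd d')}"
            by (meson disjnt_subset1 disjnt_subset2)
        qed
      qed
      have R: "\<bar>R d\<bar> \<le> e1 * measure lborel (snd d) + (if fst d \<in> Z then \<bar>F (Sup (snd d)) - F (fst d)\<bar> + \<bar>F (Inf (snd d)) - F (fst d)\<bar> else 0)"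
        if dD: "d \<in> D" for d
      proof -
        obtain x K where d: "d = (x, K)" by (cases d)
        obtain u v where uv: "Inf K = u" "Sup K = v" "u \<le> x" "x \<le> v" "a \<le> u" "v \<le> b"
          "measure lborel K = v - u" "v - x < \<delta>d x" "x - u < \<delta>d x"
          using K[of x K] dD d by auto
        show ?thesis
        proof (cases "x \<in> Z")
          case True
          have "0 \<le> e1 * (v - u)" using uv e1(1) by simp
          then have "\<bar>F v - F u\<bar> \<le> e1 * (v - u) + (\<bar>F v - F x\<bar> + \<bar>F u - F x\<bar>)" by linarith
          then show ?thesis using uv True by (simp add: R_def d g'_def abs_minus_commute)
        next
          case False
          \<comment> \<open>Both endpoints are compared with the tag. As the tag lies between them,
            the two distances add up to \<open>v - u\<close> and not to more.\<close>
          have "\<bar>F v - F x - g x * (v - x)\<bar> \<le> e1 * \<bar>v - x\<bar>" "\<bar>F u - F x - g x * (u - x)\<bar> \<le> e1 * \<bar>u - x\<bar>"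
            using False uv by (intro \<delta>d(2); auto)+
          moreover have "(v - u) * g x - (F v - F u) = (F u - F x - g x * (u - x)) - (F v - F x - g x * (v - x))"
            by (simp add: algebra_simps)
          moreover have "e1 * \<bar>v - x\<bar> + e1 * \<bar>u - x\<bar> = e1 * (v - u)"
            using uv by (simp add: algebra_simps)
          ultimately have "\<bar>(v - u) * g x - (F v - F u)\<bar> \<le> e1 * (v - u)" by linarith
          then show ?thesis using False uv by (simp add: R_def d g'_def)
        qed
      qed
      have filter: "(\<Sum>d\<in>D. if fst d \<in> Z then \<bar>F (Sup (snd d)) - F (fst d)\<bar> + \<bar>F (Inf (snd d)) - F (fst d)\<bar> else 0)
          = (\<Sum>d\<in>DZ. \<bar>F (Sup (snd d)) - F (fst d)\<bar> + \<bar>F (Inf (snd d)) - F (fst d)\<bar>)"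
        unfolding DZ_def by (rule sum.inter_filter[OF Dd(1), symmetric])
      \<comment> \<open>The increments of \<open>F\<close> telescope over the division, which turns
        the total error into a sum of local ones.\<close>
      have "(\<Sum>(x, k)\<in>D. measure lborel k *\<^sub>R g' x) - (F b - F a) = (\<Sum>d\<in>D. R d)"
        unfolding additive_tagged_division_1[OF \<open>a \<le> b\<close> D, of F, symmetric]
        by (simp add: R_def sum_subtractf[symmetric] case_prod_beta)
      then have "norm ((\<Sum>(x, k)\<in>D. measure lborel k *\<^sub>R g' x) - (F b - F a)) \<le> (\<Sum>d\<in>D. \<bar>R d\<bar>)" by simp
      also have "\<dots> \<le> (\<Sum>d\<in>D. e1 * measure lborel (snd d) + (if fst d \<in> Z then \<bar>F (Sup (snd d)) - F (fst d)\<bar> + \<bar>F (Inf (snd d)) - F (fst d)\<bar> else 0))"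
        by (intro sum_mono R)
      also have "\<dots> = e1 * (\<Sum>d\<in>D. measure lborel (snd d)) +
          ((\<Sum>d\<in>DZ. \<bar>F (Sup (snd d)) - F (fst d)\<bar>) + (\<Sum>d\<in>DZ. \<bar>F (Inf (snd d)) - F (fst d)\<bar>))"
        by (simp only: sum.distrib filter sum_distrib_left)
      also have "(\<Sum>d\<in>D. measure lborel (snd d)) = b - a"
        using additive_content_tagged_division[of D a b] D \<open>a \<le> b\<close> by (simp add: case_prod_beta)
      also have "e1 * (b - a) + ((\<Sum>d\<in>DZ. \<bar>F (Sup (snd d)) - F (fst d)\<bar>) + (\<Sum>d\<in>DZ. \<bar>F (Inf (snd d)) - F (fst d)\<bar>)) \<le> e / 4 + (e / 4 + e / 4)"
        using e1(2) right left by (intro add_mono) simp_all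
      also have "\<dots> < e" using \<open>e > 0\<close> by simp
      finally show "norm ((\<Sum>(x, k)\<in>D. measure lborel k *\<^sub>R g' x) - (F b - F a)) < e" .
    qed
  qed
  then show ?thesis
    by (rule has_integral_spike[OF Z, rotated]) (auto simp: g'_def)
qed

lemma AC_star_on_subset:
  assumes "AC_star_on E F" "E' \<subseteq> E"
  shows "AC_star_on E' F"
  unfolding AC_star_on_def
proof (intro allI impI)
  fix e :: real assume "e > 0"
  then obtain \<eta> where \<eta>: "0 < \<eta>" "\<forall>(N::nat) c d.
      (\<forall>i<N. c i \<in> E \<and> d i \<in> E \<and> c i \<le> d i) \<and> disjoint_family_on (\<lambda>i. {c i<..<d i}) {..<N} \<and>
      (\<Sum>i<N. d i - c i) < \<eta> \<longrightarrow>
      (\<Sum>i<N. SUP s\<in>{c i..d i}. SUP t\<in>{c i..d i}. ennreal \<bar>F s - F t\<bar>) < ennreal e"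
    using assms unfolding AC_star_on_def by meson
  show "\<exists>\<eta>>0. \<forall>(N::nat) c d.
      (\<forall>i<N. c i \<in> E' \<and> d i \<in> E' \<and> c i \<le> d i) \<and> disjoint_family_on (\<lambda>i. {c i<..<d i}) {..<N} \<and>
      (\<Sum>i<N. d i - c i) < \<eta> \<longrightarrow>
      (\<Sum>i<N. SUP s\<in>{c i..d i}. SUP t\<in>{c i..d i}. ennreal \<bar>F s - F t\<bar>) < ennreal e"
    using assms(2) by (intro exI[of _ \<eta>] conjI \<eta>(1) allI impI \<eta>(2)[rule_format]) auto
qed

text \<open>Needed to integrate the derivative over every \<open>{a..x}\<close>, as the Alexiewicz
  norm requires.\<close>

lemma ACG_star_subinterval:
  assumes "ACG_star a b F" "a \<le> c" "d \<le> b"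
  shows "ACG_star c d F"
proof -
  obtain E :: "nat \<Rightarrow> real set" where E: "(\<Union>i. E i) = {a..b}" "\<And>i. AC_star_on (E i) F"
    and cont: "continuous_on {a..b} F"
    using assms by (auto simp: ACG_star_def)
  have "continuous_on {c..d} F" by (rule continuous_on_subset[OF cont]) (use assms in auto)
  moreover have "(\<Union>i. E i \<inter> {c..d}) = {c..d}"
    using E(1) assms(2,3) by (simp add: Int_absorb1 flip: Int_UN_distrib2)
  moreover have "AC_star_on (E i \<inter> {c..d}) F" for i using E(2) by (rule AC_star_on_subset) auto
  ultimately show ?thesis unfolding ACG_star_def by (intro conjI exI[of _ "\<lambda>i. E i \<inter> {c..d}"]) auto
qed

lemma ACG_star_differentiable_ae:
  assumes "ACG_star a b F"
  shows "negligible {x\<in>{a..b}. \<not> F differentiable (at x)}"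
proof -
  obtain E :: "nat \<Rightarrow> real set" where E: "(\<Union>i. E i) = {a..b}" "\<And>i. AC_star_on (E i) F"
    using assms by (auto simp: ACG_star_def)
  have "negligible (\<Union>i. {x\<in>E i. \<not> F differentiable (at x)})"
    using E(2) by (intro negligible_countable_Union) (auto intro: AC_star_on_differentiable_ae)
  then show ?thesis by (rule negligible_subset) (use E(1) in blast)
qed

section \<open>Taylor's theorem\<close>

text \<open>A real-valued supremum is an upper bound only of a bounded set; boundedness holds
  because the indefinite integral is continuous on a compact interval.\<close>

lemma integral_le_alexiewicz_norm:
  assumes "g integrable_on {a..c}" "x \<in> {a..c}"
  shows "\<bar>integral {a..x} g\<bar> \<le> alexiewicz_norm a c g"
proof -
  have "continuous_on {a..c} (\<lambda>x. \<bar>integral {a..x} g\<bar>)"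
    using assms(1) by (intro continuous_intros indefinite_integral_continuous_1)
  then have "bdd_above ((\<lambda>x. \<bar>integral {a..x} g\<bar>) ` {a..c})"
    by (intro bounded_imp_bdd_above compact_imp_bounded compact_continuous_image) auto
  then show ?thesis unfolding alexiewicz_norm_def using assms(2) by (rule cSUP_upper[rotated])
qed

lemma alexiewicz_norm_le:
  assumes "a \<le> c" "\<And>x. x \<in> {a..c} \<Longrightarrow> \<bar>integral {a..x} g\<bar> \<le> B"
  shows "alexiewicz_norm a c g \<le> B"
  unfolding alexiewicz_norm_def using assms by (intro cSUP_least) auto

lemma alexiewicz_norm_nonneg:
  assumes "g integrable_on {a..c}" "a \<le> c"
  shows "0 \<le> alexiewicz_norm a c g"
  using integral_le_alexiewicz_norm[OF assms(1), of a] assms(2) by simp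

section \<open>Repeated integration and Taylor polynomials\<close>

lemma has_next_deriv_at_imp_deriv:
  assumes "has_next_deriv_at S k f x"
  shows "(nth_deriv_within S k f has_real_derivative nth_deriv_within S (Suc k) f x) (at x within S)"
  using assms
  by (simp add: has_next_deriv_at_def nth_deriv_within_def has_real_derivative_iff_has_vector_derivative
      flip: vector_derivative_works)

lemma power_over_fact_has_derivative:
  "((\<lambda>t. (t - a) ^ Suc m / fact (Suc m)) has_real_derivative (t - a) ^ m / fact m) (at t within S)"
proof -
  have "((\<lambda>t. t - a) has_real_derivative 1) (at t within S)" by (auto intro!: derivative_eq_intros)
  from DERIV_cdivide[OF DERIV_power[OF this, of "Suc m"], of "fact (Suc m)"]
  show ?thesis by (simp add: fact_Suc del: of_nat_Suc power_Suc)
qed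

lemma has_integral_power_over_fact:
  assumes "a \<le> (x::real)"
  shows "((\<lambda>t. (t - a) ^ m / fact m) has_integral (x - a) ^ Suc m / fact (Suc m)) {a..x}"
proof -
  have "((\<lambda>t. (t - a) ^ m / fact m) has_integral
      ((x - a) ^ Suc m / fact (Suc m) - (a - a) ^ Suc m / fact (Suc m))) {a..x}"
  proof (rule fundamental_theorem_of_calculus[OF assms])
    fix t
    show "((\<lambda>t. (t - a) ^ Suc m / fact (Suc m)) has_vector_derivative (t - a) ^ m / fact m)
        (at t within {a..x})"
      using power_over_fact_has_derivative[of a m t]
      by (simp only: has_real_derivative_iff_has_vector_derivative)
  qed
  then show ?thesis by simp
qed

text \<open>The induction hypothesis, applied to the shifted family, bounds \<open>h 1\<close> on
  all of \<open>{a..x}\<close>; integrating from \<open>a\<close>, where \<open>h 0\<close>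
  vanishes, raises the power and the factorial by one.\<close>

lemma iterated_derivative_bound:
  fixes h :: "nat \<Rightarrow> real \<Rightarrow> real"
  assumes "\<And>k t. k < m \<Longrightarrow> t \<in> {a..x} \<Longrightarrow> (h k has_real_derivative h (Suc k) t) (at t within {a..x})"
    and "\<And>k. k < m \<Longrightarrow> h k a = 0"
    and "\<And>t. t \<in> {a..x} \<Longrightarrow> \<bar>h m t\<bar> \<le> N"
    and "t \<in> {a..x}"
  shows "\<bar>h 0 t\<bar> \<le> N * ((t - a) ^ m / fact m)"
  using assms
proof (induction m arbitrary: h t)
  case (Suc m)
  have bound: "\<bar>h 1 s\<bar> \<le> N * ((s - a) ^ m / fact m)" if "s \<in> {a..x}" for s
    using Suc.IH[of "\<lambda>k. h (Suc k)"] Suc.prems(1-3) that by simp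
  have h1: "(h 1 has_integral (h 0 t - h 0 a)) {a..t}"
  proof (rule fundamental_theorem_of_calculus)
    fix s assume "s \<in> {a..t}"
    then have "(h 0 has_real_derivative h 1 s) (at s within {a..x})" using Suc.prems(1)[of 0 s] Suc.prems(4) by auto
    then have "(h 0 has_real_derivative h 1 s) (at s within {a..t})"
      by (rule DERIV_subset) (use Suc.prems(4) in auto)
    then show "(h 0 has_vector_derivative h 1 s) (at s within {a..t})"
      by (simp add: has_real_derivative_iff_has_vector_derivative)
  qed (use Suc.prems(4) in auto)
  have pow: "((\<lambda>s. N * ((s - a) ^ m / fact m)) has_integral N * ((t - a) ^ Suc m / fact (Suc m))) {a..t}"
    using Suc.prems(4) by (intro has_integral_mult_right has_integral_power_over_fact) auto
  have "norm (integral {a..t} (h 1)) \<le> integral {a..t} (\<lambda>s. N * ((s - a) ^ m / fact m))"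
    using bound Suc.prems(4) h1 pow by (intro integral_norm_bound_integral) auto
  then show ?case
    unfolding integral_unique[OF h1] integral_unique[OF pow] using Suc.prems(2)[of 0] by simp
qed auto

text \<open>With the factorials divided out, differentiation only shifts the coefficients, so the
  derivatives of the remainder keep one common shape.\<close>

lemma taylor_polynomial_has_derivative:
  fixes C :: "nat \<Rightarrow> real"
  shows "((\<lambda>t. \<Sum>j<Suc M. C j * (t - a) ^ j / fact j) has_real_derivative
      (\<Sum>j<M. C (Suc j) * (t - a) ^ j / fact j)) (at t within S)"
proof -
  have "((\<lambda>t. C (Suc j) * (t - a) ^ Suc j / fact (Suc j)) has_real_derivative
      C (Suc j) * (t - a) ^ j / fact j) (at t within S)" for j
    using DERIV_cmult[OF power_over_fact_has_derivative[of a j t S], of "C (Suc j)"]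
    by (simp only: times_divide_eq_right)
  then have "((\<lambda>t. C 0 + (\<Sum>j<M. C (Suc j) * (t - a) ^ Suc j / fact (Suc j))) has_real_derivative
      0 + (\<Sum>j<M. C (Suc j) * (t - a) ^ j / fact j)) (at t within S)"
    by (intro DERIV_add DERIV_const DERIV_sum)
  then show ?thesis by (simp only: sum.lessThan_Suc_shift) simp
qed

section \<open>The p-norm of a function bounded by a power\<close>

text \<open>For \<open>q = 0\<close> the integrand at \<open>a\<close> is
  \<open>0 powr 0 = 0\<close>, not the one-sided derivative 1 of the antiderivative, so the
  derivative is taken only in the interior.\<close>

lemma has_integral_powr_shift:
  assumes "a < (b::real)" "0 \<le> q"
  shows "((\<lambda>x. (x - a) powr q) has_integral (b - a) powr (q + 1) / (q + 1)) {a..b}"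
proof -
  have "((\<lambda>x. (x - a) powr q) has_integral
      ((b - a) powr (q + 1) / (q + 1) - (a - a) powr (q + 1) / (q + 1))) {a..b}"
  proof (rule fundamental_theorem_of_calculus_interior)
    show "continuous_on {a..b} (\<lambda>x. (x - a) powr (q + 1) / (q + 1))"
      using assms by (intro continuous_intros continuous_on_powr') auto
    fix x assume x: "x \<in> {a<..<b}"
    have "((\<lambda>x. (x - a) powr (q + 1) / (q + 1)) has_real_derivative
        ((q + 1) * (x - a) powr (q + 1 - 1)) / (q + 1)) (at x)"
      using x by (auto intro!: derivative_eq_intros)
    then show "((\<lambda>x. (x - a) powr (q + 1) / (q + 1)) has_vector_derivative (x - a) powr q) (at x)"
      using assms by (simp add: has_real_derivative_iff_has_vector_derivative)
  qed (use assms in auto)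
  then show ?thesis using assms by simp
qed

text \<open>Continuity makes the p-th power integrable in both senses, so the Lebesgue integral in
  \<open>Lp_norm\<close> can be estimated as a Henstock-Kurzweil integral of the power
  bound.\<close>

lemma Lp_norm_le_power_bound:
  assumes "a < b" "1 \<le> p" "0 \<le> B" and cont: "continuous_on {a..b} R" and "R a = 0"
    and bound: "\<And>x. x \<in> {a..b} \<Longrightarrow> \<bar>R x\<bar> \<le> B * (x - a) ^ m"
  shows "Lp_norm p a b R \<le> B * (b - a) powr (real m + 1 / p) / (real m * p + 1) powr (1 / p)"
proof -
  let ?q = "real m * p"
  have q: "0 \<le> ?q" using assms(2) by simp
  have "continuous_on (cbox a b) (\<lambda>x. \<bar>R x\<bar> powr p)"
    using cont assms(2) by (intro continuous_on_powr' continuous_intros) auto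
  then have int: "integrable (lebesgue_on {a..b}) (\<lambda>x. \<bar>R x\<bar> powr p)"
    and hk: "(\<lambda>x. \<bar>R x\<bar> powr p) integrable_on {a..b}"
    unfolding box_real(2)[symmetric] by (rule continuous_imp_integrable, rule integrable_continuous)
  have "(LINT x|lebesgue_on {a..b}. \<bar>R x\<bar> powr p) = integral {a..b} (\<lambda>x. \<bar>R x\<bar> powr p)"
    using int by (intro lebesgue_integral_eq_integral) auto
  also have "\<dots> \<le> integral {a..b} (\<lambda>x. B powr p * (x - a) powr ?q)"
  proof (rule integral_le)
    fix x assume x: "x \<in> {a..b}"
    show "\<bar>R x\<bar> powr p \<le> B powr p * (x - a) powr ?q"
    \<comment> \<open>At \<open>x = a\<close> the right-hand side is 0 even if \<open>m = 0\<close>,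
      while \<open>bound\<close> then gives only \<open>B\<close>; here \<open>R a = 0\<close> is
      used.\<close>
    proof (cases "x = a")
      case False
      then have "x - a > 0" using x by simp
      have "\<bar>R x\<bar> powr p \<le> (B * (x - a) ^ m) powr p"
        using bound[OF x] assms(2) by (intro powr_mono2) auto
      also have "\<dots> = B powr p * ((x - a) powr real m) powr p"
        using \<open>x - a > 0\<close> \<open>0 \<le> B\<close> by (simp add: powr_mult powr_realpow)
      also have "\<dots> = B powr p * (x - a) powr ?q" by (simp add: powr_powr)
      finally show ?thesis .
    qed (use assms in auto)
  qed (use hk has_integral_integrable[OF has_integral_mult_right[OF has_integral_powr_shift[OF assms(1) q]]]
      in auto)
  also have "\<dots> = B powr p * ((b - a) powr (?q + 1) / (?q + 1))"
    by (intro integral_unique has_integral_mult_right has_integral_powr_shift assms(1) q)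
  finally have "Lp_norm p a b R \<le> (B powr p * ((b - a) powr (?q + 1) / (?q + 1))) powr (1 / p)"
    unfolding Lp_norm_def using assms(2) by (intro powr_mono2 integral_nonneg_AE) auto
  also have "\<dots> = B * (b - a) powr ((?q + 1) / p) / (?q + 1) powr (1 / p)"
    using assms q by (simp add: powr_mult powr_divide powr_powr)
  also have "(?q + 1) / p = real m + 1 / p" using assms(2) by (simp add: field_simps)
  finally show ?thesis .
qed

theorem theorem3:
  fixes f :: "real \<Rightarrow> real" and a b x0 :: real and n :: nat
  assumes "a < b"
    and "n \<ge> 1"
    and "\<And>k x. k < n - 1 \<Longrightarrow> x \<in> {a..b} \<Longrightarrow> has_next_deriv_at {a..b} k f x"
    and "ACG_star a b (nth_deriv_within {a..b} (n - 1) f)"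
    and "x0 \<in> {a..b}"
    and "has_next_deriv_at {a..b} (n - 1) f x0"
  shows
   "(AE x in lebesgue_on {a..b}. has_next_deriv_at {a..b} (n - 1) f x) \<and>
    (nth_deriv_within {a..b} n f integrable_on {a..b}) \<and>
    (alexiewicz_norm a b (taylor_R a b n x0 f)
      \<le> (b - a) ^ n / fact n *
        alexiewicz_norm a b (\<lambda>t. nth_deriv_within {a..b} n f t - nth_deriv_within {a..b} n f x0)) \<and>
    (\<forall>x\<in>{a..b}. \<bar>taylor_R a b n x0 f x\<bar>
      \<le> (x - a) ^ (n - 1) / fact (n - 1) *
        alexiewicz_norm a x (\<lambda>t. nth_deriv_within {a..b} n f t - nth_deriv_within {a..b} n f x0)) \<and>
    (\<forall>p::real. 1 \<le> p \<longrightarrow> Lp_norm p a b (taylor_R a b n x0 f)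
      \<le> (b - a) powr (real n - 1 + 1 / p) /
          (fact (n - 1) * ((real n - 1) * p + 1) powr (1 / p)) *
        alexiewicz_norm a b (\<lambda>t. nth_deriv_within {a..b} n f t - nth_deriv_within {a..b} n f x0)) \<and>
    (Linf_norm a b (taylor_R a b n x0 f)
      \<le> ereal ((b - a) ^ (n - 1) / fact (n - 1) *
        alexiewicz_norm a b (\<lambda>t. nth_deriv_within {a..b} n f t - nth_deriv_within {a..b} n f x0)))"
proof -
  let ?d = "\<lambda>k. nth_deriv_within {a..b} k f"
  define F where "F = ?d (n - 1)"
  define g where "g = ?d n"
  define c where "c = g x0"
  define \<phi> where "\<phi> = (\<lambda>t. g t - c)"
  define R where "R = taylor_R a b n x0 f"
  define N where "N = alexiewicz_norm a b \<phi>"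
  \<comment> \<open>\<open>C\<close> lists the coefficients of the polynomial, the one of order
    \<open>n\<close> being the derivative at \<open>x0\<close>. For \<open>k < n\<close>,
    \<open>h k\<close> is the k-th derivative of \<open>R\<close>, written with the coefficients
    shifted by \<open>k\<close>.\<close>
  define C where "C = (\<lambda>j. if j < n then ?d j a else c)"
  define h where "h = (\<lambda>k t. ?d k t - (\<Sum>j<Suc (n - k). C (k + j) * (t - a) ^ j / fact j))"
  have Suc_n: "Suc (n - 1) = n" using assms(2) by simp
  define Z where "Z = {x\<in>{a..b}. \<not> F differentiable (at x)}"
  have ACG: "ACG_star a b F" using assms(4) by (simp add: F_def)
  then have Z: "negligible Z" unfolding Z_def by (rule ACG_star_differentiable_ae)
  have next_F: "has_next_deriv_at {a..b} (n - 1) f x" if "x \<in> {a..b} - Z" for x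
    using that by (auto simp: has_next_deriv_at_def Z_def F_def differentiable_at_withinI)
  have deriv_F: "(F has_real_derivative g x) (at x within {a..b})" if "x \<in> {a..b} - Z" for x
    using has_next_deriv_at_imp_deriv[OF next_F[OF that]] by (simp only: F_def g_def Suc_n)
  have g_int: "(g has_integral (F x - F a)) {a..x}" if x: "x \<in> {a..b}" for x
  proof (rule ACG_star_has_integral[OF _ _ Z])
    show "ACG_star a x F" using ACG by (rule ACG_star_subinterval) (use x in auto)
    fix t assume "t \<in> {a..x} - Z"
    then show "(F has_real_derivative g t) (at t within {a..x})"
      using x by (intro DERIV_subset[OF deriv_F]) auto
  qed (use x in auto)
  have \<phi>_int: "(\<phi> has_integral (F x - F a - c * (x - a))) {a..x}" if x: "x \<in> {a..b}" for x
    unfolding \<phi>_def using has_integral_diff[OF g_int[OF x] has_integral_const_real[of c a x]] x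
    by (simp add: mult.commute)
  have \<phi>_on: "\<phi> integrable_on {a..x}" if "x \<in> {a..b}" for x
    using \<phi>_int[OF that] by (rule has_integral_integrable)
  \<comment> \<open>The chain of derivatives valid everywhere stops at order \<open>n - 1\<close>;
    the last order exists only almost everywhere and enters through the integral of
    \<open>\<phi>\<close>.\<close>
  have h_deriv: "(h k has_real_derivative h (Suc k) t) (at t within {a..b})" if "k < n - 1" "t \<in> {a..b}" for k t
  proof -
    have "Suc (n - Suc k) = n - k" using that by simp
    then show ?thesis unfolding h_def
      using DERIV_diff[OF has_next_deriv_at_imp_deriv[OF assms(3)[OF that]]
          taylor_polynomial_has_derivative[where M = "n - k" and C = "\<lambda>j. C (k + j)"]]
      by simp
  qed
  have h_a: "h k a = 0" if "k < n" for k
    using that by (simp add: h_def C_def sum.lessThan_Suc_shift del: sum.lessThan_Suc)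
  \<comment> \<open>Two terms of the polynomial remain at this order, so the left side is
    \<open>F t - F a - c * (t - a)\<close>.\<close>
  have h_top: "h (n - 1) t = integral {a..t} \<phi>" if "t \<in> {a..b}" for t
    using assms(2) integral_unique[OF \<phi>_int[OF that]] Suc_n
    by (simp add: h_def C_def F_def lessThan_Suc)
  have h_0: "h 0 = R"
    using Suc_n by (auto simp: h_def R_def taylor_R_def taylor_P_def C_def nth_deriv_within_def c_def g_def fun_eq_iff)
  have R_a: "R a = 0" using h_a[of 0] h_0 assms(2) by simp
  \<comment> \<open>Keeping \<open>t\<close> and \<open>x\<close> apart serves twice:
    \<open>t = x\<close> is the pointwise estimate, and \<open>x = b\<close> gives the bound with
    \<open>N\<close> for the other norms.\<close>
  have bound: "\<bar>R t\<bar> \<le> alexiewicz_norm a x \<phi> * ((t - a) ^ (n - 1) / fact (n - 1))"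
    if "x \<in> {a..b}" "t \<in> {a..x}" for x t
    unfolding h_0[symmetric]
  proof (rule iterated_derivative_bound[of "n - 1" a x])
    show "(h k has_real_derivative h (Suc k) s) (at s within {a..x})" if "k < n - 1" "s \<in> {a..x}" for k s
      using that \<open>x \<in> {a..b}\<close> by (intro DERIV_subset[OF h_deriv]) auto
    show "\<bar>h (n - 1) s\<bar> \<le> alexiewicz_norm a x \<phi>" if "s \<in> {a..x}" for s
      using that \<open>x \<in> {a..b}\<close> h_top[of s] \<phi>_on[of x] by (simp add: integral_le_alexiewicz_norm)
  qed (use h_a that in auto)
  have N0: "0 \<le> N" unfolding N_def using \<phi>_on[of b] assms(1) by (intro alexiewicz_norm_nonneg) auto
  have boundN: "\<bar>R t\<bar> \<le> N * ((t - a) ^ (n - 1) / fact (n - 1))" if "t \<in> {a..b}" for t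
    using bound[of b t] that by (simp add: N_def)
  have contR: "continuous_on {a..b} R"
  \<comment> \<open>For \<open>n = 1\<close> the remainder may fail to be differentiable somewhere,
    and its continuity comes from that of ACG_* functions.\<close>
  proof (cases "n = 1")
    case True
    then have "F = f" by (simp add: F_def nth_deriv_within_def)
    then have "continuous_on {a..b} f" using ACG by (simp add: ACG_star_def)
    then show ?thesis unfolding R_def taylor_R_def taylor_P_def by (intro continuous_intros) auto
  next
    case False
    then have "(R has_real_derivative h 1 t) (at t within {a..b})" if "t \<in> {a..b}" for t
      using h_deriv[of 0 t] that assms(2) h_0 by simp
    then show ?thesis by (rule DERIV_continuous_on)
  qed
  have alex: "alexiewicz_norm a b R \<le> (b - a) ^ n / fact n * N"
  proof (rule alexiewicz_norm_le)
    fix x assume x: "x \<in> {a..b}"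
    \<comment> \<open>Integrating the pointwise bound once more turns the exponent and the factorial
      from \<open>n - 1\<close> into \<open>n\<close>.\<close>
    have int: "((\<lambda>t. N * ((t - a) ^ (n - 1) / fact (n - 1))) has_integral N * ((x - a) ^ n / fact n)) {a..x}"
      using has_integral_mult_right[OF has_integral_power_over_fact[of a x "n - 1"], of N] x
      unfolding Suc_n by simp
    have "continuous_on {a..x} R" by (rule continuous_on_subset[OF contR]) (use x in auto)
    then have "R integrable_on {a..x}" by (rule integrable_continuous_real)
    then have "norm (integral {a..x} R) \<le> integral {a..x} (\<lambda>t. N * ((t - a) ^ (n - 1) / fact (n - 1)))"
      using int x boundN by (intro integral_norm_bound_integral) (auto simp: has_integral_integrable)
    also have "\<dots> = N * ((x - a) ^ n / fact n)" using int by (rule integral_unique)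
    also have "\<dots> \<le> N * ((b - a) ^ n / fact n)"
      using x N0 by (intro mult_left_mono divide_right_mono power_mono) auto
    finally show "\<bar>integral {a..x} R\<bar> \<le> (b - a) ^ n / fact n * N" by (simp add: mult.commute)
  qed (use assms(1) in simp)
  have Lp: "Lp_norm p a b R \<le> (b - a) powr (real n - 1 + 1 / p) /
          (fact (n - 1) * ((real n - 1) * p + 1) powr (1 / p)) * N" if p: "1 \<le> p" for p
  proof -
    have "Lp_norm p a b R \<le> N / fact (n - 1) * (b - a) powr (real (n - 1) + 1 / p) / (real (n - 1) * p + 1) powr (1 / p)"
      using assms(1) p N0 contR R_a boundN by (intro Lp_norm_le_power_bound) auto
    then show ?thesis using assms(2) by (simp add: of_nat_diff mult_ac)
  qed
  have Linf: "Linf_norm a b R \<le> ereal ((b - a) ^ (n - 1) / fact (n - 1) * N)"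
    unfolding Linf_norm_def
  proof (rule esssup_I)
    have "R \<in> borel_measurable (lebesgue_on {a..b})"
      using contR by (intro continuous_imp_measurable_on_sets_lebesgue) auto
    then show "(\<lambda>x. ereal \<bar>R x\<bar>) \<in> borel_measurable (lebesgue_on {a..b})" by measurable
    show "AE x in lebesgue_on {a..b}. ereal \<bar>R x\<bar> \<le> ereal ((b - a) ^ (n - 1) / fact (n - 1) * N)"
    proof (rule AE_I2)
      fix x assume "x \<in> space (lebesgue_on {a..b})"
      then have x: "x \<in> {a..b}" by simp
      note boundN[OF x]
      also have "N * ((x - a) ^ (n - 1) / fact (n - 1)) \<le> N * ((b - a) ^ (n - 1) / fact (n - 1))"
        using x N0 by (intro mult_left_mono divide_right_mono power_mono) auto
      finally show "ereal \<bar>R x\<bar> \<le> ereal ((b - a) ^ (n - 1) / fact (n - 1) * N)"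
        by (simp add: mult.commute)
    qed
  qed
  have ae: "AE x in lebesgue_on {a..b}. has_next_deriv_at {a..b} (n - 1) f x"
  proof -
    have "AE x in lebesgue. x \<in> {a..b} \<longrightarrow> has_next_deriv_at {a..b} (n - 1) f x"
      by (rule AE_I'[of Z]) (use Z next_F in \<open>auto simp: negligible_iff_null_sets\<close>)
    then show ?thesis by (simp add: AE_restrict_space_iff)
  qed
  have g_on: "g integrable_on {a..b}" using g_int[of b] assms(1) by (auto intro: has_integral_integrable)
  have "\<forall>x\<in>{a..b}. \<bar>R x\<bar> \<le> (x - a) ^ (n - 1) / fact (n - 1) * alexiewicz_norm a x \<phi>"
    using bound by (simp add: mult.commute)
  then show ?thesis
    using ae g_on alex Lp Linf by (simp add: R_def N_def \<phi>_def g_def c_def)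
qed

end
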